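(* Let $m,p\ge1$ and $b\ge 0$ be integers. Then $$\zeta\bigl((\{1\}_m,2,\{1\}_b)\circledast(1,\{\{1\}_{m-1},2\}_{p-1},\{1\}_m)^\star\bigr)=\sum_{n=1}^\infty \frac{\zeta_{n-1}(\{1\}_{m-1},2,\{1\}_b)\,\zeta_n^\star\bigl(\{\{1\}_{m-1},2\}_{p-1},\{1\}_m\bigr)}{n^2}\in\mathbb{Q}[\text{Riemann zeta values}],$$ i.e. this number is a polynomial with rational coefficients in the values $\zeta(2),\zeta(3),\zeta(4),\ldots$.
   Context: For a finite sequence (index) of positive integers $(k_1,\ldots,k_r)$ and $n\ge 0$, $\zeta_n(k_1,\ldots,k_r)=\sum_{n\ge n_1>\cdots>n_r\ge1}\prod_j n_j^{-k_j}$ and $\zeta_n^\star(k_1,\ldots,k_r)=\sum_{n\ge n_1\ge\cdots\ge n_r\ge1}\prod_j n_j^{-k_j}$, with $\zeta_n(\emptyset)=\zeta_n^\star(\emptyset)=1$. The Kaneko–Yamamoto multiple zeta value of indices $\mathbf k=(k_1,\ldots,k_r)$, $\mathbf l=(l_1,\ldots,l_s)$ is $$\zeta(\mathbf k\circledast\mathbf l^\star)=\sum_{n=1}^\infty\frac{\zeta_{n-1}(k_2,\ldots,k_r)\,\zeta_n^\star(l_2,\ldots,l_s)}{n^{k_1+l_1}}.$$ The notation $\{s_1,\ldots,s_j\}_d$ denotes the sequence $s_1,\ldots,s_j$ repeated $d$ times (empty if $d=0$). *)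

theory Defs
  imports Complex_Main
begin

text \<open>An index \<open>(k\<^sub>1, \<dots>, k\<^sub>r)\<close> is a list of (positive) natural numbers.  The summation tuples
  \<open>(n\<^sub>1, \<dots>, n\<^sub>r)\<close> of the truncated sums are lists of the same length.\<close>

definition mzs :: "nat \<Rightarrow> nat list \<Rightarrow> real" where
  "mzs n ks =
    (\<Sum>ns | length ns = length ks \<and> set ns \<subseteq> {1..n} \<and> sorted_wrt (>) ns.
       \<Prod>j<length ks. 1 / real (ns ! j) ^ (ks ! j))"

definition mzs_star :: "nat \<Rightarrow> nat list \<Rightarrow> real" where
  "mzs_star n ks =
    (\<Sum>ns | length ns = length ks \<and> set ns \<subseteq> {1..n} \<and> sorted_wrt (\<ge>) ns.
       \<Prod>j<length ks. 1 / real (ns ! j) ^ (ks ! j))"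

text \<open>The Kaneko--Yamamoto value \<open>\<zeta>(k \<circledast> l\<^sup>\<star>)\<close> of two nonempty indices.  The summation variable of
  the usual series over \<open>n \<ge> 1\<close> is \<open>Suc n\<close> here, so that its \<open>\<zeta>\<^bsub>n-1\<^esub>\<close> becomes \<open>mzs n\<close>.  As always
  with \<open>suminf\<close>, the value is meaningful only if the series converges.\<close>

definition KY_term :: "nat list \<Rightarrow> nat list \<Rightarrow> nat \<Rightarrow> real" where
  "KY_term ks ls n =
     mzs n (tl ks) * mzs_star (Suc n) (tl ls) / real (Suc n) ^ (hd ks + hd ls)"

definition KY_zeta :: "nat list \<Rightarrow> nat list \<Rightarrow> real" where
  "KY_zeta ks ls = (\<Sum>n. KY_term ks ls n)"

definition rep :: "nat \<Rightarrow> nat list \<Rightarrow> nat list" where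
  "rep d s = concat (replicate d s)"

definition riemann_zeta :: "nat \<Rightarrow> real" where
  "riemann_zeta k = (\<Sum>n. 1 / real (Suc n) ^ k)"

text \<open>\<open>\<rat>[S]\<close>, the subring of the reals generated by \<open>\<rat>\<close> and \<open>S\<close> (closure under
  negation is multiplication by the rational \<open>-1\<close>).\<close>

inductive_set rat_adjoin :: "real set \<Rightarrow> real set" for S where
  rat: "q \<in> \<rat> \<Longrightarrow> q \<in> rat_adjoin S"
| gen: "x \<in> S \<Longrightarrow> x \<in> rat_adjoin S"
| add: "x \<in> rat_adjoin S \<Longrightarrow> y \<in> rat_adjoin S \<Longrightarrow> x + y \<in> rat_adjoin S"
| mult: "x \<in> rat_adjoin S \<Longrightarrow> y \<in> rat_adjoin S \<Longrightarrow> x * y \<in> rat_adjoin S"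

end

theory Submission
  imports Defs "HOL-Analysis.Analysis"
begin

text \<open>Write \<open>a\<^sub>n / n\<close> for the factor \<open>\<zeta>\<^sub>n\<^sup>\<star>(\<dots>) / n\<^sup>2\<close> of the series.  The Newton series
  \<open>N\<^sub>p(s)\<close> with coefficients \<open>(- 1) ^ (n - 1) a\<^sub>n\<close> (in the basis \<open>s\<close> choose \<open>n\<close>)
  interpolates \<open>\<zeta>\<^sub>s\<^sup>\<star>({m + 1}\<^sub>p)\<close>: it satisfies
  \<open>N\<^sub>p(s) - N\<^sub>p(s - 1) = N\<^sub>p\<^sub>-\<^sub>1(s) / s ^ (m + 1)\<close>.  The same equation is solved by a polynomial in the functions
  \<open>\<Sum>\<^sub>n (n ^ - k - (n + s) ^ - k)\<close>, whose Taylor coefficients at \<open>0\<close> are rational multiples of zeta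
  values; the difference of the two is periodic and tends to a constant, so they agree.
  Let \<open>\<rho>(s)\<close> be \<open>N\<^sub>p(s)\<close> without its Taylor polynomial of degree \<open>m\<close>, divided by \<open>s ^ (m + 1)\<close>.
  It is, up to sign, again a Newton series, whose coefficients arise from \<open>a\<^sub>n / n\<close> by \<open>m\<close> nested
  tail sums, which is how the \<open>{1}\<^sub>m\<^sub>-\<^sub>1, 2\<close> in the other factor appears; the value in question is,
  up to sign, the coefficient of \<open>w ^ (b + 1)\<close> in \<open>U(- w)\<close> where \<open>U(s) - U(s - 1) = \<rho>(s)\<close>.
  As \<open>N\<^sub>p(s) / s ^ (m + 1)\<close> is the difference of \<open>N\<^sub>p\<^sub>+\<^sub>1\<close>, periodicity again gives \<open>U\<close> in closed form.\<close>

section \<open>Truncated multiple harmonic sums\<close>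

lemma mzs_Nil [simp]: "mzs n [] = 1"
proof -
  have "{ns::nat list. length ns = length ([]::nat list) \<and> set ns \<subseteq> {1..n} \<and> sorted_wrt (>) ns} = {[]}"
    by auto
  then show ?thesis by (simp add: mzs_def)
qed

lemma mzs_star_Nil [simp]: "mzs_star n [] = 1"
proof -
  have "{ns::nat list. length ns = length ([]::nat list) \<and> set ns \<subseteq> {1..n} \<and> sorted_wrt (\<ge>) ns} = {[]}"
    by auto
  then show ?thesis by (simp add: mzs_star_def)
qed

lemma finite_lists_subset: "finite {ns::nat list. length ns = k \<and> set ns \<subseteq> {1..n} \<and> Q ns}"
  by (rule finite_subset[OF _ finite_lists_length_eq[of "{1..n}" k]]) auto

text \<open>Splits off the first, hence largest, entry. The bound \<open>c j\<close> on the next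
  entry lets one proof serve both kinds of sums: it is \<open>j\<close> for the strict order and
  \<open>Suc j\<close> for the weak one.\<close>

lemma sum_sorted_lists_Cons:
  fixes f :: "nat list \<Rightarrow> real"
  assumes R: "\<And>j y. R (Suc j) y \<longleftrightarrow> y \<le> c j" and c: "\<And>j. c j \<le> Suc j"
  shows "(\<Sum>ns | length ns = Suc r \<and> set ns \<subseteq> {1..n} \<and> sorted_wrt R ns. f ns) =
    (\<Sum>j<n. \<Sum>ns | length ns = r \<and> set ns \<subseteq> {1..c j} \<and> sorted_wrt R ns. f (Suc j # ns))"
proof -
  let ?A = "\<lambda>j. {ns. length ns = r \<and> set ns \<subseteq> {1..c j} \<and> sorted_wrt R ns}"
  have "(\<Sum>ns | length ns = Suc r \<and> set ns \<subseteq> {1..n} \<and> sorted_wrt R ns. f ns) =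
      (\<Sum>(j, ns)\<in>(SIGMA j:{..<n}. ?A j). f (Suc j # ns))"
  proof (rule sum.reindex_bij_witness[where i = "\<lambda>(j, ns). Suc j # ns" and j = "\<lambda>ns. (hd ns - 1, tl ns)"])
    fix a assume "a \<in> {ns. length ns = Suc r \<and> set ns \<subseteq> {1..n} \<and> sorted_wrt R ns}"
    then obtain x xs where "a = x # xs" "length xs = r" "x \<in> {1..n}" "set xs \<subseteq> {1..n}"
      "\<And>y. y \<in> set xs \<Longrightarrow> R x y" "sorted_wrt R xs"
      by (cases a) auto
    moreover then obtain j where "x = Suc j" by (cases x) auto
    ultimately have a: "a = Suc j # xs" "length xs = r" "j < n" "set xs \<subseteq> {1..c j}" "sorted_wrt R xs"
      using R by (auto simp: subset_iff)
    then show "(case (hd a - 1, tl a) of (j, ns) \<Rightarrow> Suc j # ns) = a"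
      "(hd a - 1, tl a) \<in> (SIGMA j:{..<n}. ?A j)"
      "(case (hd a - 1, tl a) of (j, ns) \<Rightarrow> f (Suc j # ns)) = f a"
      by simp_all
  next
    fix p assume "p \<in> (SIGMA j:{..<n}. ?A j)"
    then obtain j ns where p: "p = (j, ns)" "j < n" "ns \<in> ?A j" by auto
    then show "(hd (case p of (j, ns) \<Rightarrow> Suc j # ns) - 1, tl (case p of (j, ns) \<Rightarrow> Suc j # ns)) = p"
      by simp
    have "y \<le> n" if "y \<in> set ns" for y
      using that p c[of j] by force
    then show "(case p of (j, ns) \<Rightarrow> Suc j # ns) \<in>
       {ns. length ns = Suc r \<and> set ns \<subseteq> {1..n} \<and> sorted_wrt R ns}"
      using p R by (auto simp: subset_iff)
  qed
  also have "\<dots> = (\<Sum>j<n. \<Sum>ns\<in>?A j. f (Suc j # ns))"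
    by (subst sum.Sigma) (use finite_lists_subset in \<open>auto simp del: One_nat_def\<close>)
  finally show ?thesis .
qed

lemma mzs_Cons: "mzs n (k # ks) = (\<Sum>j<n. mzs j ks / real (Suc j) ^ k)"
  unfolding mzs_def list.size add_Suc_right add_0_right
  by (subst sum_sorted_lists_Cons[where c = "\<lambda>j. j"])
     (auto simp: prod.lessThan_Suc_shift sum_divide_distrib simp del: prod.lessThan_Suc)

lemma mzs_star_Cons: "mzs_star n (k # ks) = (\<Sum>j<n. mzs_star (Suc j) ks / real (Suc j) ^ k)"
  unfolding mzs_star_def list.size add_Suc_right add_0_right
  by (subst sum_sorted_lists_Cons[where c = Suc])
     (auto simp: prod.lessThan_Suc_shift sum_divide_distrib simp del: prod.lessThan_Suc)

lemma mzs_nonneg: "mzs n ks \<ge> 0"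
  by (simp add: mzs_def sum_nonneg prod_nonneg)

lemma rep_0 [simp]: "rep 0 s = []" and rep_Suc [simp]: "rep (Suc d) s = s @ rep d s"
  by (simp_all add: rep_def)

section \<open>Interchange of absolutely convergent double series\<close>

lemma suminf_swap:
  fixes f :: "nat \<Rightarrow> nat \<Rightarrow> real"
  assumes row: "\<And>i. summable (\<lambda>j. \<bar>f i j\<bar>)" and tot: "summable (\<lambda>i. \<Sum>j. \<bar>f i j\<bar>)"
  shows "\<And>j. summable (\<lambda>i. f i j)" and "summable (\<lambda>j. \<Sum>i. f i j)"
    and "(\<lambda>j. \<Sum>i. f i j) sums (\<Sum>i. \<Sum>j. f i j)"
proof -
  have row': "(\<lambda>j. norm (f i j)) summable_on UNIV" for i
    using row[of i] by (simp add: summable_on_UNIV_nonneg_real_iff)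
  have inf_row: "infsum (\<lambda>j. norm (f i j)) UNIV = (\<Sum>j. \<bar>f i j\<bar>)" for i
    using has_sum_infsum[OF row'[of i]] by (auto dest: has_sum_imp_sums simp: sums_iff)
  have tot': "(\<lambda>i. infsum (\<lambda>j. norm (f i j)) UNIV) summable_on UNIV"
    unfolding inf_row using tot
    by (simp add: summable_on_UNIV_nonneg_real_iff suminf_nonneg row)
  have abs: "(\<lambda>x. norm (case x of (i, j) \<Rightarrow> f i j)) summable_on (UNIV \<times> UNIV)"
    using row' tot' by (subst Infinite_Sum.abs_summable_on_Sigma_iff) (auto simp: infsum_nonneg)
  have sm: "(\<lambda>(i, j). f i j) summable_on (UNIV \<times> UNIV)"
    by (rule abs_summable_summable[OF abs])
  have abs': "(\<lambda>x. norm (case x of (j, i) \<Rightarrow> f i j)) summable_on (UNIV \<times> UNIV)"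
    using abs by (subst summable_on_swap) (simp add: case_prod_unfold prod.swap_def)
  have sm': "(\<lambda>(j, i). f i j) summable_on (UNIV \<times> UNIV)"
    by (rule abs_summable_summable[OF abs'])
  have col: "(\<lambda>i. norm (f i j)) summable_on UNIV" for j
    using abs' by (subst (asm) Infinite_Sum.abs_summable_on_Sigma_iff) auto
  have colh: "(\<lambda>i. f i j) sums infsum (\<lambda>i. f i j) UNIV" for j
    using has_sum_infsum[OF abs_summable_summable[OF col[of j]]] by (rule has_sum_imp_sums)
  then show "\<And>j. summable (\<lambda>i. f i j)" by (auto simp: sums_iff)
  have colinf: "infsum (\<lambda>i. f i j) UNIV = (\<Sum>i. f i j)" for j
    using colh[of j] by (simp add: sums_iff)
  have rowinf: "infsum (\<lambda>j. f i j) UNIV = (\<Sum>j. f i j)" for i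
  proof -
    have "(\<lambda>j. norm (f i j)) summable_on UNIV" using row' by simp
    from has_sum_imp_sums[OF has_sum_infsum[OF abs_summable_summable[OF this]]]
    show ?thesis by (simp add: sums_iff)
  qed
  have "(\<lambda>j. infsum (\<lambda>i. f i j) UNIV) summable_on UNIV"
    using summable_on_Sigma_banach[OF sm'] by simp
  then have "(\<lambda>j. \<Sum>i. f i j) sums infsum (\<lambda>j. \<Sum>i. f i j) UNIV"
    unfolding colinf by (intro has_sum_imp_sums has_sum_infsum)
  moreover have "infsum (\<lambda>j. \<Sum>i. f i j) UNIV = infsum (\<lambda>i. \<Sum>j. f i j) UNIV"
    using infsum_swap_banach[OF sm] by (simp add: colinf rowinf)
  moreover have "(\<lambda>i. infsum (\<lambda>j. f i j) UNIV) summable_on UNIV"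
    using summable_on_Sigma_banach[OF sm] by simp
  then have "(\<lambda>i. \<Sum>j. f i j) sums infsum (\<lambda>i. \<Sum>j. f i j) UNIV"
    unfolding rowinf by (intro has_sum_imp_sums has_sum_infsum)
  ultimately show "(\<lambda>j. \<Sum>i. f i j) sums (\<Sum>i. \<Sum>j. f i j)" by (simp add: sums_iff)
  then show "summable (\<lambda>j. \<Sum>i. f i j)" by (simp add: sums_iff)
qed

section \<open>Newton series\<close>

lemma summable_abs_le: "summable g \<Longrightarrow> (\<And>i. \<bar>f i\<bar> \<le> g i) \<Longrightarrow> summable (f :: nat \<Rightarrow> real)"
  by (rule summable_comparison_test'[of g 0]) auto

text \<open>In all sequences the index \<open>i\<close> stands for the summation variable \<open>n = i + 1\<close>, so that
  \<open>newton_poly i s\<close> is \<open>(1 - s/1) \<cdots> (1 - s/(n - 1))\<close>, that is \<open>(- 1) ^ i\<close> times the binomial coefficient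
  \<open>s - 1\<close> over \<open>i\<close>.\<close>

primrec newton_poly :: "nat \<Rightarrow> real \<Rightarrow> real" where
  "newton_poly 0 s = 1"
| "newton_poly (Suc i) s = newton_poly i s * (1 - s / real (Suc i))"

text \<open>Up to the sign \<open>(- 1) ^ i\<close>, both sides are
  \<open>s (s - 1) ... (s - i) / i!\<close>.\<close>

lemma newton_poly_shift: "s * newton_poly i s = (s - real i) * newton_poly i (s + 1)"
proof (induction i)
  case (Suc i)
  define n where "n = real (Suc i)"
  have n: "n > 0" "real i = n - 1" by (auto simp: n_def)
  have "s * newton_poly (Suc i) s = (s * newton_poly i s) * (1 - s / n)" by (simp add: n_def)
  also have "\<dots> = newton_poly i (s + 1) * ((s - (n - 1)) * (1 - s / n))"
    by (simp only: Suc n(2) mult_ac)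
  also have "(s - (n - 1)) * (1 - s / n) = (s - n) * (1 - (s + 1) / n)"
    using n(1) by (simp add: field_simps)
  finally show ?case by (simp add: n_def mult_ac)
qed simp

text \<open>Pascal's rule for the binomial coefficient \<open>s\<close> over
  \<open>Suc i\<close>.\<close>

lemma newton_poly_plus_one: "newton_poly (Suc i) (s + 1) = newton_poly (Suc i) s - newton_poly i s"
proof -
  define n where "n = real (Suc i)"
  have n: "n > 0" "real i = n - 1" by (auto simp: n_def)
  have "newton_poly (Suc i) (s + 1) = - ((s - real i) * newton_poly i (s + 1)) / n"
    unfolding newton_poly.simps n_def[symmetric] n(2) using n(1) by (simp add: field_simps)
  also have "\<dots> = - (s * newton_poly i s) / n"
    by (simp only: newton_poly_shift)
  also have "\<dots> = newton_poly (Suc i) s - newton_poly i s"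
    unfolding newton_poly.simps n_def[symmetric] using n(1) by (simp add: field_simps)
  finally show ?thesis .
qed

text \<open>Pascal's rule again: up to sign, \<open>s * newton_poly i s / Suc i\<close> is the
  binomial coefficient \<open>s\<close> over \<open>Suc i\<close>, whose backward difference is
  \<open>s - 1\<close> over \<open>i\<close>.\<close>

lemma newton_poly_diff: "s * newton_poly i s / real (Suc i) - (s - 1) * newton_poly i (s - 1) / real (Suc i) = newton_poly i s"
proof -
  have "s * newton_poly i s - (s - 1) * newton_poly i (s - 1) = real (Suc i) * newton_poly i s"
    using newton_poly_shift[of "s - 1" i] by (simp add: algebra_simps)
  then show ?thesis by (simp add: diff_divide_distrib[symmetric] del: of_nat_Suc)
qed

text \<open>Telescoping of \<open>newton_poly (Suc l) s - newton_poly l s\<close>. The factor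
  \<open>s\<close> split off here is what produces the tail sums later.\<close>

lemma newton_poly_eq_sum: "newton_poly i s = 1 - s * (\<Sum>l<i. newton_poly l s / real (Suc l))"
  by (induction i) (simp_all add: algebra_simps)

lemma newton_poly_unit_interval:
  assumes "0 \<le> s" "s \<le> 1"
  shows "0 \<le> newton_poly i s" "newton_poly i s \<le> 1"
proof -
  have f: "0 \<le> 1 - s / real (Suc i)" "1 - s / real (Suc i) \<le> 1" for i
    using assms by (auto simp: divide_simps)
  show g: "0 \<le> newton_poly i s" for i
    by (induction i) (simp_all only: newton_poly.simps mult_nonneg_nonneg[OF _ f(1)] zero_le_one)
  show "newton_poly i s \<le> 1"
  proof (induction i)
    case (Suc i)
    then show ?case using mult_mono[OF Suc f(2)[of i]] f(1)[of i] by simp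
  qed simp
qed

lemma newton_poly_one: "newton_poly i 1 = (if i = 0 then 1 else 0)"
  by (induction i) auto

lemma newton_poly_neg_ge_one: "t \<ge> 0 \<Longrightarrow> newton_poly i (- t) \<ge> 1"
proof (induction i)
  case (Suc i)
  then show ?case using mult_mono[of 1 "newton_poly i (-t)" 1 "1 + t / real (Suc i)"] by simp
qed simp

lemma newton_poly_neg_mono:
  assumes "\<bar>s\<bar> \<le> t"
  shows "\<bar>newton_poly i s\<bar> \<le> newton_poly i (- t)"
proof (induction i)
  case (Suc i)
  have "\<bar>1 - s / real (Suc i)\<bar> \<le> 1 + \<bar>s\<bar> / real (Suc i)"
    using abs_triangle_ineq4[of 1 "s / real (Suc i)"] by (simp add: abs_divide)
  also have "\<dots> \<le> 1 + t / real (Suc i)" using assms by (simp add: divide_right_mono)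
  finally have "\<bar>newton_poly i s\<bar> * \<bar>1 - s / real (Suc i)\<bar> \<le> newton_poly i (- t) * (1 + t / real (Suc i))"
    using Suc by (intro mult_mono) auto
  then show ?case by (simp add: abs_mult)
qed simp

text \<open>Beyond some \<open>N \<ge> s\<close> all new factors lie in \<open>[0, 1]\<close>, so
  the absolute value no longer grows; up to \<open>N\<close> it is dominated by the value at
  \<open>- s\<close>, which increases with \<open>i\<close>.\<close>

lemma newton_poly_bounded:
  assumes "s \<ge> 0"
  obtains C where "C \<ge> 0" "\<And>i. \<bar>newton_poly i s\<bar> \<le> C"
proof -
  obtain N where N: "s \<le> real N" using real_arch_simple by blast
  have "\<bar>newton_poly i s\<bar> \<le> newton_poly N (- s)" for i
  proof (cases "i \<le> N")
    case True
    have "newton_poly i (- s) \<le> newton_poly N (- s)" using True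
    proof (induction N rule: dec_induct)
      case (step n)
      have "newton_poly n (- s) * 1 \<le> newton_poly n (- s) * (1 + s / real (Suc n))"
        using newton_poly_neg_ge_one[of s n] assms by (intro mult_left_mono) auto
      then show ?case using step by simp
    qed simp
    then show ?thesis using newton_poly_neg_mono[of s s i] assms by simp
  next
    case False
    then have "N \<le> i" by simp
    then show ?thesis
    proof (induction i rule: dec_induct)
      case base
      show ?case using newton_poly_neg_mono[of s s N] assms by simp
    next
      case (step n)
      have "0 \<le> s / real (Suc n)" "s / real (Suc n) \<le> 1" using assms N step by (auto simp: divide_simps)
      then have "\<bar>newton_poly n s\<bar> * \<bar>1 - s / real (Suc n)\<bar> \<le> newton_poly N (- s) * 1"
        using step by (intro mult_mono) auto
      then show ?case by (simp add: abs_mult)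
    qed
  qed
  then show ?thesis using that[of "newton_poly N (- s)"] newton_poly_neg_ge_one[OF assms, of N] by auto
qed

text \<open>Provides a majorant of the kind that \<open>admissible\<close> is tested against. For
  \<open>s \<ge> 0\<close> any \<open>t\<close> between \<open>0\<close> and \<open>1\<close> would
  do.\<close>

lemma newton_poly_dominated:
  assumes "s > -1"
  obtains C t where "C \<ge> 0" "0 < t" "t < 1" "\<And>i. \<bar>newton_poly i s\<bar> \<le> C * newton_poly i (- t)"
proof (cases "s \<ge> 0")
  case True
  then obtain C where C: "C \<ge> 0" "\<And>i. \<bar>newton_poly i s\<bar> \<le> C" using newton_poly_bounded by blast
  have "\<bar>newton_poly i s\<bar> \<le> C * newton_poly i (- (1/2))" for i
    using C(2)[of i] mult_left_mono[OF newton_poly_neg_ge_one[of "1/2" i] C(1)] by linarith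
  then show ?thesis using that[of C "1/2"] C(1) by simp
next
  case False
  then show ?thesis
    using that[of 1 "-s"] newton_poly_neg_mono[of s "-s"] assms by simp
qed

text \<open>\<open>newton_poly i (- w)\<close> is the product of \<open>1 + w / k\<close> over
  \<open>1 \<le> k \<le> i\<close>, and \<open>mzs i (rep b [1])\<close> is the \<open>b\<close>-th
  elementary symmetric polynomial in the \<open>1 / k\<close>. All but finitely many terms
  vanish.\<close>

lemma newton_poly_mzs: "(\<lambda>b. mzs i (rep b [1]) * w ^ b) sums newton_poly i (- w)"
proof (induction i)
  case 0
  have "mzs 0 (rep b [1]) * w ^ b = (if b = 0 then 1 else 0)" for b
    by (cases b) (simp_all add: mzs_Cons)
  then show ?case using sums_single[of 0 "\<lambda>_. 1::real"] by simp
next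
  case (Suc i)
  have "(\<lambda>b. mzs i (rep b [1]) * w ^ b * (w / real (Suc i))) sums (newton_poly i (- w) * (w / real (Suc i)))"
    by (rule sums_mult2[OF Suc])
  then have "(\<lambda>b. if b = 0 then 0 else mzs i (rep (b - 1) [1]) * w ^ (b - 1) * (w / real (Suc i)))
     sums (newton_poly i (- w) * (w / real (Suc i)))"
    using sums_Suc[of "\<lambda>b. if b = 0 then 0 else mzs i (rep (b - 1) [1]) * w ^ (b - 1) * (w / real (Suc i))"]
    by simp
  from sums_add[OF Suc this]
  have "(\<lambda>b. mzs i (rep b [1]) * w ^ b + (if b = 0 then 0 else mzs i (rep (b - 1) [1]) * w ^ (b - 1) * (w / real (Suc i))))
     sums (newton_poly (Suc i) (- w))"
    by (simp add: algebra_simps)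
  moreover have "mzs i (rep b [1]) * w ^ b + (if b = 0 then 0 else mzs i (rep (b - 1) [1]) * w ^ (b - 1) * (w / real (Suc i)))
     = mzs (Suc i) (rep b [1]) * w ^ b" for b
    by (cases b) (simp_all add: mzs_Cons algebra_simps)
  ultimately show ?case by simp
qed

section \<open>Newton series with admissible coefficients and operations on them\<close>

definition newton_sum :: "(nat \<Rightarrow> real) \<Rightarrow> real \<Rightarrow> real" where
  "newton_sum \<eta> s = (\<Sum>i. \<eta> i * newton_poly i s)"

text \<open>\<open>s * newton_sum (div_Suc \<eta>) s\<close> is the Newton series with coefficients
  \<open>\<eta>\<close>, up to sign, in the basis \<open>s\<close> choose \<open>n\<close>; hence
  this combination recurs below.\<close>

definition div_Suc :: "(nat \<Rightarrow> real) \<Rightarrow> nat \<Rightarrow> real" where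
  "div_Suc \<eta> i = \<eta> i / real (Suc i)"

text \<open>On Newton series this acts as division by \<open>s\<close>, see
  \<open>newton_sum_average\<close>.\<close>

definition average :: "(nat \<Rightarrow> real) \<Rightarrow> nat \<Rightarrow> real" where
  "average \<eta> i = (\<Sum>k\<le>i. \<eta> k) / real (Suc i)"

definition tail_sum :: "(nat \<Rightarrow> real) \<Rightarrow> nat \<Rightarrow> real" where
  "tail_sum \<eta> l = (\<Sum>i. if l < i then \<eta> i else 0)"

text \<open>As \<open>newton_poly i (- t)\<close> grows like \<open>i\<close> to the power \<open>t\<close>, this class contains the sequences that decay
  like \<open>i\<^sup>-\<^sup>2\<close> up to logarithms; their Newton series converge for all \<open>s > -1\<close>.\<close>

definition admissible :: "(nat \<Rightarrow> real) \<Rightarrow> bool" where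
  "admissible \<eta> \<longleftrightarrow> (\<forall>i. 0 \<le> \<eta> i) \<and> (\<forall>t. 0 < t \<longrightarrow> t < 1 \<longrightarrow> summable (\<lambda>i. \<eta> i * newton_poly i (- t)))"

lemma admissible_nonneg: "admissible \<eta> \<Longrightarrow> 0 \<le> \<eta> i"
  by (simp add: admissible_def)

lemma admissible_summableD: "admissible \<eta> \<Longrightarrow> 0 < t \<Longrightarrow> t < 1 \<Longrightarrow> summable (\<lambda>i. \<eta> i * newton_poly i (- t))"
  by (simp add: admissible_def)

lemma admissible_abs_summable:
  assumes "admissible \<eta>" "s > -1"
  shows "summable (\<lambda>i. \<bar>\<eta> i * newton_poly i s\<bar>)"
proof -
  obtain C t where C: "C \<ge> 0" "0 < t" "t < 1" "\<And>i. \<bar>newton_poly i s\<bar> \<le> C * newton_poly i (- t)"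
    using newton_poly_dominated[OF assms(2)] by blast
  have "summable (\<lambda>i. C * (\<eta> i * newton_poly i (- t)))"
    by (intro summable_mult admissible_summableD assms C)
  then show ?thesis
  proof (rule summable_abs_le)
    fix i
    show "\<bar>\<bar>\<eta> i * newton_poly i s\<bar>\<bar> \<le> C * (\<eta> i * newton_poly i (- t))" using mult_left_mono[OF C(4)[of i] admissible_nonneg[OF assms(1), of i]]
      by (simp add: abs_mult admissible_nonneg[OF assms(1)] mult.left_commute)
  qed
qed

lemma admissible_sums: "admissible \<eta> \<Longrightarrow> s > -1 \<Longrightarrow> (\<lambda>i. \<eta> i * newton_poly i s) sums newton_sum \<eta> s"
  unfolding newton_sum_def by (rule summable_sums[OF summable_rabs_cancel[OF admissible_abs_summable]])

lemma admissible_summable: "admissible \<eta> \<Longrightarrow> summable \<eta>"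
proof -
  have "newton_poly i 0 = 1" for i by (induction i) auto
  then show "admissible \<eta> \<Longrightarrow> summable \<eta>" using admissible_sums[of \<eta> 0] by (simp add: sums_iff)
qed

lemma admissible_mono:
  assumes "admissible \<eta>" "\<And>i. 0 \<le> \<theta> i" "\<And>i. \<theta> i \<le> \<eta> i"
  shows "admissible \<theta>"
  unfolding admissible_def
proof (intro conjI allI impI)
  fix t :: real assume t: "0 < t" "t < 1"
  have "summable (\<lambda>i. \<eta> i * newton_poly i (- t))" by (intro admissible_summableD assms t)
  then show "summable (\<lambda>i. \<theta> i * newton_poly i (- t))"
  proof (rule summable_abs_le)
    fix i
    have "0 \<le> newton_poly i (- t)" using newton_poly_neg_ge_one[of t i] t by simp
    then show "\<bar>\<theta> i * newton_poly i (- t)\<bar> \<le> \<eta> i * newton_poly i (- t)" by (simp add: abs_mult assms mult_right_mono)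
  qed
qed (use assms in auto)

lemma admissible_div_Suc: "admissible \<eta> \<Longrightarrow> admissible (div_Suc \<eta>)"
proof (rule admissible_mono)
  fix i assume "admissible \<eta>"
  then have "0 \<le> \<eta> i" by (rule admissible_nonneg)
  then show "0 \<le> div_Suc \<eta> i" "div_Suc \<eta> i \<le> \<eta> i"
    using mult_left_mono[of 1 "real (Suc i)" "\<eta> i"] by (simp_all add: div_Suc_def divide_simps)
qed

text \<open>Comparison with a telescoping series: for
  \<open>q i = newton_poly i (- t) / Suc i\<close> the decrease \<open>q i - q (Suc i)\<close>
  equals \<open>1 - t\<close> times \<open>newton_poly i (- t) / (Suc i * Suc (Suc i))\<close>. The
  factor \<open>2\<close> pays for replacing this denominator by a square.\<close>

lemma newton_poly_neg_over_square:
  assumes t: "0 < t" "t < 1"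
  shows "summable (\<lambda>i. if k \<le> i then newton_poly i (- t) / real (Suc i) ^ 2 else 0)"
    and "(\<Sum>i. if k \<le> i then newton_poly i (- t) / real (Suc i) ^ 2 else 0)
           \<le> 2 / (1 - t) * (newton_poly k (- t) / real (Suc k))"
proof -
  let ?q = "\<lambda>i. newton_poly i (- t) / real (Suc i)"
  let ?f = "\<lambda>i. if k \<le> i then newton_poly i (- t) / real (Suc i) ^ 2 else 0"
  have pos: "0 < newton_poly i (- t)" for i using newton_poly_neg_ge_one[of t i] t by simp
  have step: "newton_poly i (- t) / real (Suc i) ^ 2 \<le> 2 / (1 - t) * (?q i - ?q (Suc i))" for i
  proof -
    define x where "x = real i + 1"
    have x: "x \<ge> 1" "real (Suc i) = x" "real (Suc (Suc i)) = x + 1" by (auto simp: x_def)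
    have "?q i - ?q (Suc i) = newton_poly i (- t) * ((1 - t) / (x * (x + 1)))"
      using x(1) unfolding newton_poly.simps x(2,3) by (simp add: divide_simps) (simp add: algebra_simps)
    then have "2 / (1 - t) * (?q i - ?q (Suc i)) = newton_poly i (- t) * (2 / (x * (x + 1)))"
      using t by simp
    moreover have "newton_poly i (- t) * (1 / x ^ 2) \<le> newton_poly i (- t) * (2 / (x * (x + 1)))"
      using pos[of i] x(1) by (intro mult_left_mono) (auto simp: divide_simps power2_eq_square)
    ultimately show ?thesis unfolding x(2) by simp
  qed
  have fnn: "?f i \<ge> 0" for i using pos[of i] by simp
  have bd: "(\<Sum>i<n. ?f i) \<le> 2 / (1 - t) * (?q k - (if k \<le> n then ?q n else ?q k))" for n
  proof (induction n)
    case (Suc n)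
    show ?case
    proof (cases "k \<le> n")
      case True
      then show ?thesis using Suc step[of n] by (simp add: right_diff_distrib)
    next
      case False
      then have "k = Suc n \<or> \<not> k \<le> Suc n" by auto
      with False Suc show ?thesis by auto
    qed
  qed auto
  have bd': "(\<Sum>i<n. ?f i) \<le> 2 / (1 - t) * ?q k" for n
  proof -
    have "2 / (1 - t) * (?q k - (if k \<le> n then ?q n else ?q k)) \<le> 2 / (1 - t) * ?q k"
      using pos[of n] pos[of k] t by (intro mult_left_mono) auto
    then show ?thesis using bd[of n] by linarith
  qed
  show sm: "summable ?f"
    by (rule summableI_nonneg_bounded[OF fnn bd'])
  show "suminf ?f \<le> 2 / (1 - t) * ?q k"
    by (rule suminf_le_const[OF sm bd'])
qed

lemma admissible_inverse_squares: "admissible (div_Suc (div_Suc (\<lambda>_. 1)))"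
  unfolding admissible_def
proof (intro conjI allI impI)
  fix t :: real assume "0 < t" "t < 1"
  from newton_poly_neg_over_square(1)[OF this, of 0]
  show "summable (\<lambda>i. div_Suc (div_Suc (\<lambda>_. 1)) i * newton_poly i (- t))"
    by (simp add: div_Suc_def power2_eq_square)
qed (auto simp: div_Suc_def)

text \<open>After exchanging the sums, \<open>\<eta> k\<close> is weighted by the tail from
  \<open>k\<close> of \<open>newton_poly i (- t) / Suc i ^ 2\<close>, which is at most a constant
  times \<open>newton_poly k (- t) / Suc k\<close>.\<close>

lemma admissible_average:
  assumes "admissible (div_Suc \<eta>)"
  shows "admissible (div_Suc (average \<eta>))"
  unfolding admissible_def
proof (intro conjI allI impI)
  have nn: "0 \<le> \<eta> i" for i using admissible_nonneg[OF assms, of i] by (simp add: div_Suc_def divide_simps)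
  then show "0 \<le> div_Suc (average \<eta>) i" for i by (simp add: div_Suc_def average_def sum_nonneg)
  fix t :: real assume t: "0 < t" "t < 1"
  have pos: "0 < newton_poly i (- t)" for i using newton_poly_neg_ge_one[of t i] t by simp
  define f where "f k i = \<eta> k * (if k \<le> i then newton_poly i (- t) / real (Suc i) ^ 2 else 0)" for k i
  have fnn: "f k i \<ge> 0" for k i using nn[of k] pos[of i] by (simp add: f_def)
  have row: "summable (\<lambda>i. \<bar>f k i\<bar>)" for k
    using fnn newton_poly_neg_over_square(1)[OF t] by (simp add: f_def summable_mult)
  have le: "(\<Sum>i. \<bar>f k i\<bar>) \<le> 2 / (1 - t) * (div_Suc \<eta> k * newton_poly k (- t))" for k
  proof -
    have "(\<Sum>i. \<bar>f k i\<bar>) = \<eta> k * (\<Sum>i. if k \<le> i then newton_poly i (- t) / real (Suc i) ^ 2 else 0)"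
      using fnn by (simp add: f_def suminf_mult[OF newton_poly_neg_over_square(1)[OF t]])
    also have "\<dots> \<le> \<eta> k * (2 / (1 - t) * (newton_poly k (- t) / real (Suc k)))"
      by (intro mult_left_mono newton_poly_neg_over_square(2) t nn)
    finally show ?thesis by (simp add: div_Suc_def mult_ac)
  qed
  have "summable (\<lambda>k. 2 / (1 - t) * (div_Suc \<eta> k * newton_poly k (- t)))"
    by (intro summable_mult admissible_summableD assms t)
  then have tot: "summable (\<lambda>k. \<Sum>i. \<bar>f k i\<bar>)"
  proof (rule summable_abs_le)
    fix k
    have "0 \<le> (\<Sum>i. \<bar>f k i\<bar>)" by (intro suminf_nonneg row) simp
    then show "\<bar>\<Sum>i. \<bar>f k i\<bar>\<bar> \<le> 2 / (1 - t) * (div_Suc \<eta> k * newton_poly k (- t))" using le[of k] by linarith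
  qed
  have "(\<Sum>k. f k i) = div_Suc (average \<eta>) i * newton_poly i (- t)" for i
  proof -
    have "(\<lambda>k. f k i) sums (\<Sum>k\<le>i. f k i)"
      by (rule sums_finite) (auto simp: f_def)
    also have "(\<Sum>k\<le>i. f k i) = div_Suc (average \<eta>) i * newton_poly i (- t)"
      by (simp add: f_def div_Suc_def average_def power2_eq_square sum_distrib_right sum_divide_distrib)
    finally show ?thesis by (simp add: sums_iff)
  qed
  with suminf_swap(2)[OF row tot] show "summable (\<lambda>i. div_Suc (average \<eta>) i * newton_poly i (- t))" by simp
qed

text \<open>Fubini over the pairs \<open>l < i\<close>. Absolute convergence holds because
  \<open>newton_poly_eq_sum\<close> at \<open>- t\<close> bounds the inner sum by a multiple of
  \<open>newton_poly i (- t)\<close>. The sequence \<open>x\<close> will be a Newton polynomial or a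
  multiple harmonic sum.\<close>

lemma tail_sum_swap:
  fixes x :: "nat \<Rightarrow> real"
  assumes "admissible \<eta>" "0 < t" "t < 1" "\<And>l. \<bar>x l\<bar> \<le> C * newton_poly l (- t)"
  shows "summable (\<lambda>i. \<eta> i * (\<Sum>l<i. x l / real (Suc l)))"
    and "(\<lambda>l. div_Suc (tail_sum \<eta>) l * x l) sums (\<Sum>i. \<eta> i * (\<Sum>l<i. x l / real (Suc l)))"
proof -
  define f where "f i l = (if l < i then \<eta> i else 0) * (x l / real (Suc l))" for i l
  have C: "C \<ge> 0" using assms(4)[of 0] by auto
  have fin: "(\<lambda>l. f i l) sums (\<eta> i * (\<Sum>l<i. x l / real (Suc l)))" for i
  proof -
    have "(\<lambda>l. f i l) sums (\<Sum>l<i. f i l)" by (rule sums_finite) (auto simp: f_def)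
    then show ?thesis by (simp add: f_def sum_distrib_left)
  qed
  have fina: "(\<lambda>l. \<bar>f i l\<bar>) sums (\<eta> i * (\<Sum>l<i. \<bar>x l\<bar> / real (Suc l)))" for i
  proof -
    have "(\<lambda>l. \<bar>f i l\<bar>) sums (\<Sum>l<i. \<bar>f i l\<bar>)" by (rule sums_finite) (auto simp: f_def)
    then show ?thesis by (simp add: f_def sum_distrib_left abs_mult admissible_nonneg[OF assms(1)])
  qed
  have le: "(\<Sum>l<i. \<bar>x l\<bar> / real (Suc l)) \<le> C / t * newton_poly i (- t)" for i
  proof -
    have "(\<Sum>l<i. \<bar>x l\<bar> / real (Suc l)) \<le> (\<Sum>l<i. C * newton_poly l (- t) / real (Suc l))"
      by (intro sum_mono divide_right_mono assms) auto
    also have "\<dots> = C / t * (newton_poly i (- t) - 1)"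
    proof -
      have "newton_poly i (- t) - 1 = t * (\<Sum>l<i. newton_poly l (- t) / real (Suc l))"
        by (subst newton_poly_eq_sum) simp
      then show ?thesis using assms(2) by (simp add: sum_distrib_left)
    qed
    also have "\<dots> \<le> C / t * newton_poly i (- t)"
      using C assms(2) by (intro mult_left_mono) auto
    finally show ?thesis .
  qed
  have "summable (\<lambda>i. C / t * (\<eta> i * newton_poly i (- t)))"
    by (intro summable_mult admissible_summableD assms)
  then have sa: "summable (\<lambda>i. \<eta> i * (\<Sum>l<i. \<bar>x l\<bar> / real (Suc l)))"
  proof (rule summable_abs_le)
    fix i
    show "\<bar>\<eta> i * (\<Sum>l<i. \<bar>x l\<bar> / real (Suc l))\<bar> \<le> C / t * (\<eta> i * newton_poly i (- t))" using mult_left_mono[OF le[of i] admissible_nonneg[OF assms(1), of i]]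
      by (simp add: abs_mult admissible_nonneg[OF assms(1)] sum_nonneg mult.left_commute)
  qed
  then show "summable (\<lambda>i. \<eta> i * (\<Sum>l<i. x l / real (Suc l)))"
  proof (rule summable_abs_le)
    fix i
    have "\<bar>\<Sum>l<i. x l / real (Suc l)\<bar> \<le> (\<Sum>l<i. \<bar>x l\<bar> / real (Suc l))"
      by (rule order_trans[OF sum_abs]) simp
    then show "\<bar>\<eta> i * (\<Sum>l<i. x l / real (Suc l))\<bar> \<le> \<eta> i * (\<Sum>l<i. \<bar>x l\<bar> / real (Suc l))"
      by (simp add: abs_mult admissible_nonneg[OF assms(1)] mult_left_mono)
  qed
  have row: "summable (\<lambda>l. \<bar>f i l\<bar>)" for i using fina[of i] by (simp add: sums_iff)
  have tot: "summable (\<lambda>i. \<Sum>l. \<bar>f i l\<bar>)" using fina sa by (simp add: sums_iff)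
  have sc: "summable (\<lambda>i. if l < i then \<eta> i else 0)" for l
    using admissible_summable[OF assms(1)]
    by (rule summable_abs_le) (auto simp: admissible_nonneg[OF assms(1)])
  have "(\<Sum>i. f i l) = div_Suc (tail_sum \<eta>) l * x l" for l
    unfolding f_def by (subst suminf_mult2[OF sc, symmetric]) (simp add: div_Suc_def tail_sum_def)
  moreover have "(\<Sum>l. f i l) = \<eta> i * (\<Sum>l<i. x l / real (Suc l))" for i
    using fin[of i] by (simp add: sums_iff)
  ultimately show "(\<lambda>l. div_Suc (tail_sum \<eta>) l * x l) sums (\<Sum>i. \<eta> i * (\<Sum>l<i. x l / real (Suc l)))"
    using suminf_swap(3)[OF row tot] by simp
qed

lemma tail_sum_nonneg: "admissible \<eta> \<Longrightarrow> 0 \<le> tail_sum \<eta> l"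
  unfolding tail_sum_def
proof (intro suminf_nonneg)
  assume w: "admissible \<eta>"
  show "summable (\<lambda>i. if l < i then \<eta> i else 0)"
    using admissible_summable[OF w] by (rule summable_abs_le) (auto simp: admissible_nonneg[OF w])
qed (auto simp: admissible_nonneg)

lemma admissible_tail_sum:
  assumes "admissible \<eta>"
  shows "admissible (div_Suc (tail_sum \<eta>))"
  unfolding admissible_def
proof (intro conjI allI impI)
  show "0 \<le> div_Suc (tail_sum \<eta>) i" for i by (simp add: div_Suc_def tail_sum_nonneg[OF assms])
  fix t :: real assume t: "0 < t" "t < 1"
  have "\<bar>newton_poly l (- t)\<bar> \<le> 1 * newton_poly l (- t)" for l using newton_poly_neg_mono[of "-t" t l] t by simp
  from tail_sum_swap(2)[OF assms t this] show "summable (\<lambda>i. div_Suc (tail_sum \<eta>) i * newton_poly i (- t))"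
    by (simp add: sums_iff)
qed

text \<open>One step of Taylor expansion at \<open>0\<close>: insert
  \<open>newton_poly_eq_sum\<close> in each term and exchange the sums. The constant
  \<open>suminf \<eta>\<close> is the value at \<open>0\<close>.\<close>

lemma newton_sum_tail_sum:
  assumes "admissible \<eta>" "s > -1"
  shows "newton_sum \<eta> s = suminf \<eta> - s * newton_sum (div_Suc (tail_sum \<eta>)) s"
proof -
  obtain C t where C: "0 < t" "t < 1" "\<And>i. \<bar>newton_poly i s\<bar> \<le> C * newton_poly i (- t)"
    using newton_poly_dominated[OF assms(2)] by blast
  note sw = tail_sum_swap[OF assms(1) C]
  have "newton_sum (div_Suc (tail_sum \<eta>)) s = (\<Sum>i. \<eta> i * (\<Sum>l<i. newton_poly l s / real (Suc l)))"
    using sw(2) by (simp add: newton_sum_def sums_iff)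
  moreover have "(\<lambda>i. \<eta> i - s * (\<eta> i * (\<Sum>l<i. newton_poly l s / real (Suc l)))) sums
      (suminf \<eta> - s * (\<Sum>i. \<eta> i * (\<Sum>l<i. newton_poly l s / real (Suc l))))"
    by (intro sums_diff sums_mult summable_sums sw(1) admissible_summable assms)
  moreover have "\<eta> i - s * (\<eta> i * (\<Sum>l<i. newton_poly l s / real (Suc l))) = \<eta> i * newton_poly i s" for i
    by (subst newton_poly_eq_sum) (simp add: algebra_simps)
  ultimately show ?thesis by (simp add: newton_sum_def sums_iff)
qed

section \<open>Completely monotone coefficients\<close>

text \<open>Complete monotonicity is what controls a Newton series at large non-integral arguments, where
  its terms are huge and cancel: shifting the argument by one replaces the coefficients by their
  differences, which stay nonnegative.\<close>

primrec fdiff :: "nat \<Rightarrow> (nat \<Rightarrow> real) \<Rightarrow> nat \<Rightarrow> real" where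
  "fdiff 0 \<eta> = \<eta>"
| "fdiff (Suc k) \<eta> = (\<lambda>n. fdiff k \<eta> n - fdiff k \<eta> (Suc n))"

lemma fdiff_Suc': "fdiff (Suc k) \<eta> = fdiff k (\<lambda>n. \<eta> n - \<eta> (Suc n))"
  by (induction k) simp_all

definition completely_monotone :: "(nat \<Rightarrow> real) \<Rightarrow> bool" where
  "completely_monotone \<eta> \<longleftrightarrow> (\<forall>k n. 0 \<le> fdiff k \<eta> n)"

lemma completely_monotone_nonneg: "completely_monotone \<eta> \<Longrightarrow> 0 \<le> \<eta> n"
  unfolding completely_monotone_def by (metis fdiff.simps(1))

lemma completely_monotone_diff: "completely_monotone \<eta> \<Longrightarrow> completely_monotone (\<lambda>n. \<eta> n - \<eta> (Suc n))"
  unfolding completely_monotone_def by (metis fdiff_Suc')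

lemma completely_monotone_const: "c \<ge> 0 \<Longrightarrow> completely_monotone (\<lambda>_. c)"
proof -
  have "fdiff k (\<lambda>_. c) = (\<lambda>_. if k = 0 then c else 0)" for k
    by (induction k) auto
  then show "c \<ge> 0 \<Longrightarrow> completely_monotone (\<lambda>_. c)" by (simp add: completely_monotone_def)
qed

text \<open>The Leibniz rule for higher differences, applied to the product
  \<open>Suc i * div_Suc \<eta> i = \<eta> i\<close>.\<close>

lemma fdiff_div_Suc:
  "real (Suc i) * fdiff (Suc k) (div_Suc \<eta>) i = fdiff (Suc k) \<eta> i + real (Suc k) * fdiff k (div_Suc \<eta>) (Suc i)"
proof (induction k arbitrary: i)
  case 0
  have "real (Suc j) * div_Suc \<eta> j = \<eta> j" for j by (simp add: div_Suc_def)
  from this[of i] this[of "Suc i"] show ?case by (simp add: algebra_simps)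
next
  case (Suc k)
  have "real (Suc i) * fdiff (Suc (Suc k)) (div_Suc \<eta>) i =
      real (Suc i) * fdiff (Suc k) (div_Suc \<eta>) i - real (Suc (Suc i)) * fdiff (Suc k) (div_Suc \<eta>) (Suc i)
      + fdiff (Suc k) (div_Suc \<eta>) (Suc i)"
    unfolding fdiff.simps(2)[of "Suc k"] by (simp add: algebra_simps)
  also have "\<dots> = fdiff (Suc (Suc k)) \<eta> i + real (Suc (Suc k)) * fdiff (Suc k) (div_Suc \<eta>) (Suc i)"
    unfolding Suc by (simp add: algebra_simps)
  finally show ?case .
qed

lemma completely_monotone_div_Suc:
  assumes "completely_monotone \<eta>"
  shows "completely_monotone (div_Suc \<eta>)"
  unfolding completely_monotone_def
proof (intro allI)
  fix k n show "0 \<le> fdiff k (div_Suc \<eta>) n"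
  proof (induction k arbitrary: n)
    case 0
    then show ?case by (simp add: div_Suc_def completely_monotone_nonneg[OF assms])
  next
    case (Suc k)
    have "0 \<le> real (Suc n) * fdiff (Suc k) (div_Suc \<eta>) n"
      using Suc[of "Suc n"] assms unfolding fdiff_div_Suc completely_monotone_def
      by (intro add_nonneg_nonneg mult_nonneg_nonneg) (auto simp del: fdiff.simps)
    then show ?case by (simp only: zero_le_mult_iff) auto
  qed
qed

lemma average_Suc: "real (Suc (Suc i)) * average \<eta> (Suc i) = \<eta> (Suc i) + real (Suc i) * average \<eta> i"
  by (simp add: average_def)

text \<open>The \<open>k\<close>-th difference of \<open>average_Suc\<close>; each induction step
  subtracts the instance at \<open>Suc i\<close> from that at \<open>i\<close>. Both coefficients on
  the right are positive, so nonnegativity passes from \<open>i\<close> to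
  \<open>Suc i\<close>.\<close>

lemma fdiff_average_Suc:
  "real (Suc (Suc i) + k) * fdiff k (average \<eta>) (Suc i) = fdiff k \<eta> (Suc i) + real (Suc i) * fdiff k (average \<eta>) i"
proof (induction k arbitrary: i)
  case 0
  show ?case using average_Suc[of i \<eta>] by simp
next
  case (Suc k)
  show ?case using Suc[of i] Suc[of "Suc i"] by (simp add: algebra_simps)
qed

lemma fdiff_average_0: "real (Suc k) * fdiff k (average \<eta>) 0 = fdiff k \<eta> 0"
proof (induction k)
  case (Suc k)
  show ?case using Suc fdiff_average_Suc[of 0 k \<eta>] by (simp add: algebra_simps)
qed (simp add: average_def)

lemma completely_monotone_average:
  assumes "completely_monotone \<eta>"
  shows "completely_monotone (average \<eta>)"
  unfolding completely_monotone_def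
proof (intro allI)
  fix k n
  have nn: "0 \<le> fdiff k \<eta> j" for j using assms by (simp add: completely_monotone_def)
  show "0 \<le> fdiff k (average \<eta>) n"
  proof (induction n)
    case 0
    show ?case using fdiff_average_0[of k \<eta>] nn[of 0]
      by (metis of_nat_0_less_iff zero_le_mult_iff zero_less_Suc less_le_not_le)
  next
    case (Suc n)
    have "0 \<le> real (Suc (Suc n) + k) * fdiff k (average \<eta>) (Suc n)"
      unfolding fdiff_average_Suc using nn Suc by (intro add_nonneg_nonneg mult_nonneg_nonneg) auto
    then show ?case by (simp only: zero_le_mult_iff) auto
  qed
qed

text \<open>The first difference of \<open>tail_sum \<eta>\<close> at \<open>l\<close> is
  \<open>\<eta> (Suc l)\<close>, so all higher differences are differences of
  \<open>\<eta>\<close>.\<close>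

lemma completely_monotone_tail_sum:
  assumes "admissible \<eta>" "completely_monotone \<eta>"
  shows "completely_monotone (tail_sum \<eta>)"
proof -
  have "tail_sum \<eta> l - tail_sum \<eta> (Suc l) = \<eta> (Suc l)" for l
  proof -
    have sm: "summable (\<lambda>i. if l < i then \<eta> i else 0)" for l
      using admissible_summable[OF assms(1)] by (rule summable_abs_le) (auto simp: admissible_nonneg[OF assms(1)])
    have "tail_sum \<eta> l - tail_sum \<eta> (Suc l) = (\<Sum>i. (if l < i then \<eta> i else 0) - (if Suc l < i then \<eta> i else 0))"
      unfolding tail_sum_def by (rule suminf_diff[OF sm sm])
    also have "(\<lambda>i. (if l < i then \<eta> i else 0) - (if Suc l < i then \<eta> i else 0)) =
        (\<lambda>i. if i = Suc l then \<eta> i else 0)"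
      by (auto simp: fun_eq_iff)
    also have "suminf \<dots> = \<eta> (Suc l)"
      using sums_single[of "Suc l" \<eta>] by (simp add: sums_iff)
    finally show ?thesis .
  qed
  then have "fdiff (Suc k) (tail_sum \<eta>) = fdiff k (\<lambda>l. \<eta> (Suc l))" for k
    by (simp only: fdiff_Suc')
  moreover have "fdiff k (\<lambda>l. \<eta> (Suc l)) n = fdiff k \<eta> (Suc n)" for k n
    by (induction k arbitrary: n) simp_all
  ultimately have "fdiff (Suc k) (tail_sum \<eta>) n \<ge> 0" for k n
    using assms(2) by (simp add: completely_monotone_def del: fdiff.simps)
  moreover have "fdiff 0 (tail_sum \<eta>) n \<ge> 0" for n by (simp add: tail_sum_nonneg[OF assms(1)])
  ultimately show ?thesis unfolding completely_monotone_def by (metis not0_implies_Suc)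
qed

lemma summable_mult_newton_poly:
  assumes "summable \<eta>" "\<And>i. 0 \<le> \<eta> i" "s \<ge> 0"
  shows "summable (\<lambda>i. \<eta> i * newton_poly i s)"
proof -
  obtain C where C: "\<And>i. \<bar>newton_poly i s\<bar> \<le> C" using newton_poly_bounded[OF assms(3)] by blast
  show ?thesis
  proof (rule summable_abs_le)
    show "summable (\<lambda>i. \<eta> i * C)" by (rule summable_mult2[OF assms(1)])
    show "\<bar>\<eta> i * newton_poly i s\<bar> \<le> \<eta> i * C" for i
      using assms(2)[of i] C[of i] by (simp add: abs_mult mult_left_mono)
  qed
qed

text \<open>Pascal's rule \<open>newton_poly_plus_one\<close> followed by a shift of the summation
  index.\<close>

lemma newton_sum_plus_one:
  assumes "completely_monotone \<eta>" "summable \<eta>" "s \<ge> 0"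
  shows "newton_sum \<eta> (s + 1) = newton_sum (\<lambda>n. \<eta> n - \<eta> (Suc n)) s"
proof -
  have sm: "summable (\<lambda>i. \<eta> i * newton_poly i s)"
    by (rule summable_mult_newton_poly) (use assms completely_monotone_nonneg in auto)
  have sm': "summable (\<lambda>i. \<eta> (Suc i) * newton_poly i s)"
    by (rule summable_mult_newton_poly) (use assms completely_monotone_nonneg in \<open>auto simp: summable_Suc_iff\<close>)
  have "(\<lambda>i. \<eta> (Suc i) * newton_poly (Suc i) s - \<eta> (Suc i) * newton_poly i s) sums
      ((newton_sum \<eta> s - \<eta> 0 * newton_poly 0 s) - (\<Sum>i. \<eta> (Suc i) * newton_poly i s))"
    using summable_sums[OF sm] unfolding newton_sum_def
    by (intro sums_diff summable_sums[OF sm']) (subst sums_Suc_iff, simp)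
  then have "(\<lambda>i. \<eta> (Suc i) * newton_poly (Suc i) (s + 1)) sums
      ((newton_sum \<eta> s - \<eta> 0) - (\<Sum>i. \<eta> (Suc i) * newton_poly i s))"
    unfolding newton_poly_plus_one right_diff_distrib by simp
  then have "(\<lambda>i. \<eta> i * newton_poly i (s + 1)) sums
      ((newton_sum \<eta> s - \<eta> 0) - (\<Sum>i. \<eta> (Suc i) * newton_poly i s) + \<eta> 0 * newton_poly 0 (s + 1))"
    by (subst (asm) sums_Suc_iff) simp
  then have "newton_sum \<eta> (s + 1) = newton_sum \<eta> s - (\<Sum>i. \<eta> (Suc i) * newton_poly i s)"
    by (simp add: newton_sum_def sums_iff)
  also have "\<dots> = newton_sum (\<lambda>n. \<eta> n - \<eta> (Suc n)) s"
    unfolding newton_sum_def left_diff_distrib by (rule suminf_diff[OF sm sm'])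
  finally show ?thesis .
qed

text \<open>For \<open>K = 0\<close> the comparison holds term by term, since
  \<open>newton_poly i s\<close> lies between its values at \<open>1\<close> and \<open>0\<close>.
  Larger \<open>K\<close> reduce to this by \<open>newton_sum_plus_one\<close>, which keeps the
  coefficients completely monotone.\<close>

lemma newton_sum_sandwich:
  assumes "completely_monotone \<eta>" "summable \<eta>" "0 \<le> s" "s \<le> 1"
  shows "newton_sum \<eta> (real (Suc K)) \<le> newton_sum \<eta> (real K + s)"
    and "newton_sum \<eta> (real K + s) \<le> newton_sum \<eta> (real K)"
    and "0 \<le> newton_sum \<eta> (real K)"
proof -
  have "newton_sum \<eta> (1 + real K) \<le> newton_sum \<eta> (real K + s) \<and>
      newton_sum \<eta> (real K + s) \<le> newton_sum \<eta> (real K) \<and> 0 \<le> newton_sum \<eta> (real K)"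
    using assms(1,2)
  proof (induction K arbitrary: \<eta>)
    case 0
    have sm: "0 \<le> u \<Longrightarrow> summable (\<lambda>i. \<eta> i * newton_poly i u)" for u
      by (rule summable_mult_newton_poly) (use 0 completely_monotone_nonneg in auto)
    have "newton_poly i 1 \<le> newton_poly i s" "newton_poly i s \<le> newton_poly i 0" "0 \<le> newton_poly i 0" for i
      using newton_poly_unit_interval[OF assms(3,4), of i] newton_poly_one[of i]
      by (auto simp: newton_poly_eq_sum[of i 0])
    then have "newton_sum \<eta> 1 \<le> newton_sum \<eta> s" "newton_sum \<eta> s \<le> newton_sum \<eta> 0" "0 \<le> newton_sum \<eta> 0"
      unfolding newton_sum_def
      by (auto intro!: suminf_le mult_left_mono sm suminf_nonneg mult_nonneg_nonneg assms completely_monotone_nonneg[OF 0(1)])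
    then show ?case by simp
  next
    case (Suc K)
    let ?d = "\<lambda>n. \<eta> n - \<eta> (Suc n)"
    have "summable ?d" using Suc by (intro summable_diff) (auto simp: summable_Suc_iff)
    then have *: "newton_sum ?d (1 + real K) \<le> newton_sum ?d (real K + s) \<and>
        newton_sum ?d (real K + s) \<le> newton_sum ?d (real K) \<and> 0 \<le> newton_sum ?d (real K)"
      using Suc by (intro Suc.IH completely_monotone_diff)
    have "newton_sum ?d (1 + real K) = newton_sum \<eta> (1 + real (Suc K))"
      "newton_sum ?d (real K + s) = newton_sum \<eta> (real (Suc K) + s)"
      "newton_sum ?d (real K) = newton_sum \<eta> (real (Suc K))"
      using newton_sum_plus_one[OF Suc.prems, of "1 + real K"] newton_sum_plus_one[OF Suc.prems, of "real K + s"]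
        newton_sum_plus_one[OF Suc.prems, of "real K"] assms(3) by (simp_all add: ac_simps)
    with * show ?case by simp
  qed
  then show "newton_sum \<eta> (real (Suc K)) \<le> newton_sum \<eta> (real K + s)"
    and "newton_sum \<eta> (real K + s) \<le> newton_sum \<eta> (real K)"
    and "0 \<le> newton_sum \<eta> (real K)"
    by simp_all
qed

section \<open>Newton series at infinity, their differences, and division by the argument\<close>

lemma cesaro_0:
  fixes f :: "nat \<Rightarrow> real"
  assumes "(\<lambda>K. f (Suc K) - f K) \<longlonglongrightarrow> 0"
  shows "(\<lambda>K. f K / real K) \<longlonglongrightarrow> 0"
proof (rule LIMSEQ_I)
  fix r :: real assume r: "0 < r"
  from LIMSEQ_D[OF assms, of "r/2"] r
  obtain N where N: "\<And>K. K \<ge> N \<Longrightarrow> \<bar>f (Suc K) - f K\<bar> < r / 2" by auto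
  have bd: "\<bar>f K\<bar> \<le> \<bar>f N\<bar> + r / 2 * real K" if "K \<ge> N" for K
    using that
  proof (induction K rule: dec_induct)
    case base
    then show ?case using r by simp
  next
    case (step n)
    have "\<bar>f (Suc n)\<bar> \<le> \<bar>f n\<bar> + r / 2" using N[OF step(1)] by linarith
    then show ?case using step(3) by (simp add: field_simps)
  qed
  obtain M where M: "2 * \<bar>f N\<bar> / r < real M" using reals_Archimedean2 by blast
  show "\<exists>no. \<forall>n\<ge>no. norm (f n / real n - 0) < r"
  proof (intro exI allI impI)
    fix n assume n: "n \<ge> max N (Suc M)"
    then have "2 * \<bar>f N\<bar> / r < real n" using M by linarith
    then have "\<bar>f N\<bar> < r / 2 * real n" using r by (simp add: field_simps)
    then have "\<bar>f n\<bar> < r * real n" using bd[of n] n by (simp add: field_simps)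
    then show "norm (f n / real n - 0) < r" using n by (simp add: field_simps)
  qed
qed

text \<open>Extends a limit along integers to real shifts. By \<open>cesaro_0\<close> the values
  \<open>newton_sum \<eta> (real K)\<close> tend to \<open>0\<close>, and
  \<open>newton_sum_sandwich\<close> then traps the increment between two null sequences.\<close>

lemma newton_sum_shift_tendsto:
  fixes \<eta> :: "nat \<Rightarrow> real" and f :: "real \<Rightarrow> real"
  defines "f \<equiv> \<lambda>s. s * newton_sum \<eta> s"
  assumes mono: "completely_monotone \<eta>" "summable \<eta>" and lim: "(\<lambda>K. f (real (Suc K)) - f (real K)) \<longlonglongrightarrow> 0"
    and s: "0 \<le> s" "s \<le> 1"
  shows "(\<lambda>K. f (real K + s) - f (real K)) \<longlonglongrightarrow> 0"
proof -
  let ?M = "newton_sum \<eta>"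
  have "(\<lambda>K. f (real K) / real K) \<longlonglongrightarrow> 0" by (rule cesaro_0[OF lim])
  moreover have "\<forall>\<^sub>F K in sequentially. f (real K) / real K = ?M (real K)"
    using eventually_gt_at_top[of 0] by eventually_elim (simp add: f_def)
  ultimately have M0: "(\<lambda>K. ?M (real K)) \<longlonglongrightarrow> 0" by (rule Lim_transform_eventually)
  show ?thesis
  proof (rule tendsto_sandwich)
    show "\<forall>\<^sub>F K in sequentially. (f (real (Suc K)) - f (real K)) - (1 - s) * ?M (real (Suc K)) \<le> f (real K + s) - f (real K)"
    proof (intro always_eventually allI)
      fix K
      have "(real K + s) * ?M (real (Suc K)) \<le> (real K + s) * ?M (real K + s)"
        using s newton_sum_sandwich(1)[OF mono s] by (intro mult_left_mono) auto
      then show "(f (real (Suc K)) - f (real K)) - (1 - s) * ?M (real (Suc K)) \<le> f (real K + s) - f (real K)"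
        by (simp add: f_def algebra_simps)
    qed
    show "\<forall>\<^sub>F K in sequentially. f (real K + s) - f (real K) \<le> s * ?M (real K)"
    proof (intro always_eventually allI)
      fix K
      have "(real K + s) * ?M (real K + s) \<le> (real K + s) * ?M (real K)"
        using s newton_sum_sandwich(2)[OF mono s] by (intro mult_left_mono) auto
      then show "f (real K + s) - f (real K) \<le> s * ?M (real K)"
        by (simp add: f_def algebra_simps)
    qed
    show "(\<lambda>K. s * ?M (real K)) \<longlonglongrightarrow> 0" using tendsto_mult_right_zero[OF M0] .
    show "(\<lambda>K. f (real (Suc K)) - f (real K) - (1 - s) * ?M (real (Suc K))) \<longlonglongrightarrow> 0"
      using tendsto_diff[OF lim tendsto_mult_right_zero[OF LIMSEQ_Suc[OF M0], of "1 - s"]] by simp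
  qed
qed

text \<open>Termwise this is \<open>newton_poly_diff\<close>. The same identity gives absolute
  convergence for \<open>s > 0\<close> of the Newton series of \<open>\<eta>\<close>, which itself
  need not be admissible.\<close>

lemma newton_sum_div_Suc_diff:
  assumes "admissible (div_Suc \<eta>)" "s > 0"
  shows "summable (\<lambda>i. \<bar>\<eta> i * newton_poly i s\<bar>)"
    and "s * newton_sum (div_Suc \<eta>) s - (s - 1) * newton_sum (div_Suc \<eta>) (s - 1) = newton_sum \<eta> s"
proof -
  have eq: "s * (div_Suc \<eta> i * newton_poly i s) - (s - 1) * (div_Suc \<eta> i * newton_poly i (s - 1)) = \<eta> i * newton_poly i s" for i
    using arg_cong[OF newton_poly_diff[of s i], of "\<lambda>x. \<eta> i * x"] by (simp add: div_Suc_def right_diff_distrib mult_ac)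
  have "(\<lambda>i. s * (div_Suc \<eta> i * newton_poly i s) - (s - 1) * (div_Suc \<eta> i * newton_poly i (s - 1))) sums
     (s * newton_sum (div_Suc \<eta>) s - (s - 1) * newton_sum (div_Suc \<eta>) (s - 1))"
    using assms by (intro sums_diff sums_mult admissible_sums) auto
  then show "s * newton_sum (div_Suc \<eta>) s - (s - 1) * newton_sum (div_Suc \<eta>) (s - 1) = newton_sum \<eta> s"
    unfolding eq by (simp add: newton_sum_def sums_iff)
  have "summable (\<lambda>i. \<bar>s\<bar> * \<bar>div_Suc \<eta> i * newton_poly i s\<bar> + \<bar>s - 1\<bar> * \<bar>div_Suc \<eta> i * newton_poly i (s - 1)\<bar>)"
    using assms by (intro summable_add summable_mult admissible_abs_summable) auto
  then show "summable (\<lambda>i. \<bar>\<eta> i * newton_poly i s\<bar>)"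
  proof (rule summable_abs_le)
    fix i
    show "\<bar>\<bar>\<eta> i * newton_poly i s\<bar>\<bar> \<le> \<bar>s\<bar> * \<bar>div_Suc \<eta> i * newton_poly i s\<bar> + \<bar>s - 1\<bar> * \<bar>div_Suc \<eta> i * newton_poly i (s - 1)\<bar>"
      using abs_triangle_ineq4[of "s * (div_Suc \<eta> i * newton_poly i s)" "(s - 1) * (div_Suc \<eta> i * newton_poly i (s - 1))"]
      unfolding eq by (simp add: abs_mult)
  qed
qed

text \<open>In the summation by parts the boundary term has a limit \<open>c\<close>, and \<open>c \<noteq> 0\<close> would make the harmonic
  series converge.\<close>

lemma newton_sum_average:
  assumes "admissible (div_Suc \<eta>)" "s > 0"
  shows "newton_sum (average \<eta>) s = newton_sum \<eta> s / s"
proof -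
  define A where "A n = (\<Sum>k<n. \<eta> k)" for n
  have nn: "0 \<le> \<eta> i" for i using admissible_nonneg[OF assms(1), of i] by (simp add: div_Suc_def divide_simps)
  have wa: "admissible (div_Suc (average \<eta>))" by (rule admissible_average[OF assms(1)])
  have sma: "summable (\<lambda>i. \<bar>average \<eta> i * newton_poly i s\<bar>)"
    by (rule newton_sum_div_Suc_diff(1)[OF wa assms(2)])
  have smb: "summable (\<lambda>i. \<bar>\<eta> i * newton_poly i s\<bar>)"
    by (rule newton_sum_div_Suc_diff(1)[OF assms])
  have fin: "s * (\<Sum>i<n. average \<eta> i * newton_poly i s) = (\<Sum>i<n. \<eta> i * newton_poly i s) - A n * newton_poly n s" for n
  proof (induction n)
    case (Suc n)
    have "A (Suc n) = real (Suc n) * average \<eta> n" by (simp add: A_def average_def lessThan_Suc_atMost)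
    then have "A (Suc n) * newton_poly (Suc n) s = A (Suc n) * newton_poly n s - s * (average \<eta> n * newton_poly n s)"
      by (simp add: field_simps)
    then show ?case using Suc by (simp add: A_def algebra_simps)
  qed (simp add: A_def)
  have lima: "(\<lambda>n. \<Sum>i<n. average \<eta> i * newton_poly i s) \<longlonglongrightarrow> newton_sum (average \<eta>) s"
    unfolding newton_sum_def by (rule summable_LIMSEQ[OF summable_rabs_cancel[OF sma]])
  have limb: "(\<lambda>n. \<Sum>i<n. \<eta> i * newton_poly i s) \<longlonglongrightarrow> newton_sum \<eta> s"
    unfolding newton_sum_def by (rule summable_LIMSEQ[OF summable_rabs_cancel[OF smb]])
  define c where "c = newton_sum \<eta> s - s * newton_sum (average \<eta>) s"
  have "(\<lambda>n. (\<Sum>i<n. \<eta> i * newton_poly i s) - s * (\<Sum>i<n. average \<eta> i * newton_poly i s)) \<longlonglongrightarrow> c"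
    unfolding c_def by (intro tendsto_intros lima limb)
  then have limA: "(\<lambda>n. A n * newton_poly n s) \<longlonglongrightarrow> c" unfolding fin by simp
  have "c = 0"
  proof (rule ccontr)
    assume "c \<noteq> 0"
    then have cp: "\<bar>c\<bar> / 2 > 0" by simp
    have "(\<lambda>n. \<bar>A n * newton_poly n s\<bar>) \<longlonglongrightarrow> \<bar>c\<bar>" by (rule tendsto_rabs[OF limA])
    then have ev: "\<forall>\<^sub>F n in sequentially. \<bar>A n * newton_poly n s\<bar> > \<bar>c\<bar> / 2"
      using cp by (intro order_tendstoD) auto
    have le: "\<bar>A n * newton_poly n s\<bar> \<le> real (Suc n) * \<bar>average \<eta> n * newton_poly n s\<bar>" for n
    proof -
      have "0 \<le> A n" "A n \<le> real (Suc n) * average \<eta> n"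
        using nn by (auto simp: A_def average_def sum_nonneg lessThan_Suc_atMost[symmetric])
      then have "A n * \<bar>newton_poly n s\<bar> \<le> real (Suc n) * average \<eta> n * \<bar>newton_poly n s\<bar>"
        by (intro mult_right_mono) auto
      moreover have "0 \<le> average \<eta> n" using nn by (simp add: average_def sum_nonneg)
      ultimately show ?thesis using \<open>0 \<le> A n\<close> by (simp add: abs_mult)
    qed
    have "summable (\<lambda>n. \<bar>c\<bar> / 2 * (1 / real (Suc n)))"
    proof (rule summable_comparison_test_ev)
      show "summable (\<lambda>i. \<bar>average \<eta> i * newton_poly i s\<bar>)" by (rule sma)
      show "\<forall>\<^sub>F n in sequentially. norm (\<bar>c\<bar> / 2 * (1 / real (Suc n))) \<le> \<bar>average \<eta> n * newton_poly n s\<bar>"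
        using ev
      proof eventually_elim
        case (elim n)
        have "\<bar>c\<bar> / 2 \<le> real (Suc n) * \<bar>average \<eta> n * newton_poly n s\<bar>" using elim le[of n] by linarith
        then have "\<bar>c\<bar> / 2 / real (Suc n) \<le> \<bar>average \<eta> n * newton_poly n s\<bar>"
          by (subst pos_divide_le_eq) (simp_all add: mult.commute)
        then show ?case by simp
      qed
    qed
    then have "summable (\<lambda>n. 1 / real (Suc n))"
      using cp unfolding summable_cmult_iff by linarith
    then show False using not_summable_harmonic[where 'a = real]
      by (subst (asm) summable_Suc_iff[of "\<lambda>n. 1 / real n"]) (simp add: inverse_eq_divide)
  qed
  then show ?thesis using assms(2) by (simp add: c_def field_simps)
qed

text \<open>The sequence \<open>1 / Suc i\<close> is the average of the sequence
  \<open>1, 0, 0, ...\<close>, whose Newton series is constantly \<open>1\<close>.\<close>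

lemma newton_sum_div_Suc_one:
  assumes "s > 0"
  shows "newton_sum (div_Suc (\<lambda>_. 1)) s = 1 / s"
proof -
  have e: "average (\<lambda>i. if i = 0 then 1 else 0) = div_Suc (\<lambda>_. 1)"
    by (simp add: average_def div_Suc_def fun_eq_iff)
  have "admissible (div_Suc (\<lambda>i. if i = 0 then 1 else 0))"
    unfolding admissible_def
  proof (intro conjI allI impI)
    fix t :: real
    show "summable (\<lambda>i. div_Suc (\<lambda>i. if i = 0 then 1 else 0) i * newton_poly i (- t))"
      by (rule summable_finite[of "{0}"]) (auto simp: div_Suc_def)
  qed (auto simp: div_Suc_def)
  from newton_sum_average[OF this assms] have "newton_sum (div_Suc (\<lambda>_. 1)) s = newton_sum (\<lambda>i. if i = 0 then 1 else 0) s / s"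
    unfolding e .
  moreover have "(\<lambda>i. (if i = 0 then 1 else 0) * newton_poly i s) sums 1"
    using sums_single[of 0 "\<lambda>_. 1::real"] by (rule back_subst[of "\<lambda>f. f sums 1"]) (auto simp: fun_eq_iff)
  ultimately show ?thesis by (simp add: newton_sum_def sums_iff)
qed

section \<open>Power series with coefficients generated by zeta values\<close>

lemma rat_adjoin_uminus: "x \<in> rat_adjoin S \<Longrightarrow> - x \<in> rat_adjoin S"
  using rat_adjoin.mult[OF rat_adjoin.rat[of "-1" S], of x] by simp

lemma rat_adjoin_sum: "(\<And>i. i \<in> A \<Longrightarrow> f i \<in> rat_adjoin S) \<Longrightarrow> sum f A \<in> rat_adjoin S"
  by (induction A rule: infinite_finite_induct) (auto intro: rat_adjoin.intros)

text \<open>The radius \<open>1\<close> is dictated by the pole of \<open>zeta_diff k (- w)\<close>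
  at \<open>w = 1\<close> for \<open>k \<ge> 1\<close>.\<close>

definition powser_over :: "real set \<Rightarrow> (real \<Rightarrow> real) \<Rightarrow> bool" where
  "powser_over S f \<longleftrightarrow> (\<exists>c. (\<forall>j. c j \<in> rat_adjoin S) \<and> (\<forall>w. \<bar>w\<bar> < 1 \<longrightarrow> (\<lambda>j. c j * w ^ j) sums f w))"

lemma powser_over_const:
  assumes "q \<in> rat_adjoin S"
  shows "powser_over S (\<lambda>_. q)"
  unfolding powser_over_def
proof (intro exI[of _ "\<lambda>j. if j = 0 then q else 0"] conjI allI impI)
  fix w :: real
  have "(\<lambda>j. if j = 0 then q else 0) sums q" using sums_single[of 0 "\<lambda>_. q"] by simp
  then show "(\<lambda>j. (if j = 0 then q else 0) * w ^ j) sums q"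
    by (rule back_subst[of "\<lambda>f. f sums q"]) auto
qed (use assms rat_adjoin.rat[of 0 S] in auto)

lemma powser_over_add:
  assumes "powser_over S f" "powser_over S g"
  shows "powser_over S (\<lambda>w. f w + g w)"
proof -
  obtain c d where "\<forall>j. c j \<in> rat_adjoin S" "\<And>w. \<bar>w\<bar> < 1 \<Longrightarrow> (\<lambda>j. c j * w ^ j) sums f w"
    "\<forall>j. d j \<in> rat_adjoin S" "\<And>w. \<bar>w\<bar> < 1 \<Longrightarrow> (\<lambda>j. d j * w ^ j) sums g w"
    using assms unfolding powser_over_def by blast
  then show ?thesis unfolding powser_over_def
    by (intro exI[of _ "\<lambda>j. c j + d j"]) (auto simp: distrib_right intro: rat_adjoin.add sums_add)
qed

lemma powser_over_mult:
  assumes "powser_over S f" "powser_over S g"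
  shows "powser_over S (\<lambda>w. f w * g w)"
proof -
  obtain c d where c: "\<forall>j. c j \<in> rat_adjoin S" "\<And>w. \<bar>w\<bar> < 1 \<Longrightarrow> (\<lambda>j. c j * w ^ j) sums f w"
    and d: "\<forall>j. d j \<in> rat_adjoin S" "\<And>w. \<bar>w\<bar> < 1 \<Longrightarrow> (\<lambda>j. d j * w ^ j) sums g w"
    using assms unfolding powser_over_def by blast
  have abs: "summable (\<lambda>j. norm (c j * w ^ j))"
    if c: "\<And>w. \<bar>w\<bar> < 1 \<Longrightarrow> (\<lambda>j. c j * w ^ j) sums f w" and w: "\<bar>w\<bar> < 1" for c f and w :: real
  proof (rule powser_insidea)
    \<comment> \<open>Convergence at a point strictly between \<open>\<bar>w\<bar>\<close> and
      \<open>1\<close> gives absolute convergence at \<open>w\<close>.\<close>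
    have "\<bar>(\<bar>w\<bar> + 1) / 2\<bar> < 1" using w by auto
    then show "summable (\<lambda>j. c j * ((\<bar>w\<bar> + 1) / 2) ^ j)" using c by (metis sums_summable)
    show "norm w < norm ((\<bar>w\<bar> + 1) / 2)" using w by auto
  qed
  show ?thesis unfolding powser_over_def
  proof (intro exI[of _ "\<lambda>k. \<Sum>i\<le>k. c i * d (k - i)"] conjI allI impI)
    fix w :: real assume w: "\<bar>w\<bar> < 1"
    have "(\<lambda>k. \<Sum>i\<le>k. (c i * w ^ i) * (d (k - i) * w ^ (k - i))) sums
       ((\<Sum>j. c j * w ^ j) * (\<Sum>j. d j * w ^ j))"
      by (rule Cauchy_product_sums[OF abs[OF c(2) w] abs[OF d(2) w]])
    also have "(\<lambda>k. \<Sum>i\<le>k. (c i * w ^ i) * (d (k - i) * w ^ (k - i))) =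
        (\<lambda>k. (\<Sum>i\<le>k. c i * d (k - i)) * w ^ k)"
    proof (rule ext)
      fix k
      have "(c i * w ^ i) * (d (k - i) * w ^ (k - i)) = c i * d (k - i) * w ^ k" if "i \<le> k" for i
        using that power_add[of w i "k - i"] by (simp add: mult_ac)
      then show "(\<Sum>i\<le>k. (c i * w ^ i) * (d (k - i) * w ^ (k - i))) = (\<Sum>i\<le>k. c i * d (k - i)) * w ^ k"
        unfolding sum_distrib_right by (intro sum.cong) auto
    qed
    finally show "(\<lambda>k. (\<Sum>i\<le>k. c i * d (k - i)) * w ^ k) sums (f w * g w)"
      using c(2)[OF w] d(2)[OF w] by (simp add: sums_iff)
  next
    show "(\<Sum>i\<le>k. c i * d (k - i)) \<in> rat_adjoin S" for k
      by (intro rat_adjoin_sum rat_adjoin.mult) (use c d in auto)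
  qed
qed

lemma powser_over_cmult: "q \<in> rat_adjoin S \<Longrightarrow> powser_over S f \<Longrightarrow> powser_over S (\<lambda>w. q * f w)"
  by (rule powser_over_mult[OF powser_over_const])

lemma powser_over_sum: "(\<And>i. i \<in> A \<Longrightarrow> powser_over S (f i)) \<Longrightarrow> powser_over S (\<lambda>w. \<Sum>i\<in>A. f i w)"
  by (induction A rule: infinite_finite_induct)
     (simp_all add: powser_over_add powser_over_const rat_adjoin.rat)

lemma powser_unique:
  fixes c d :: "nat \<Rightarrow> real"
  assumes "\<And>w. \<bar>w\<bar> < 1 \<Longrightarrow> (\<lambda>j. c j * w ^ j) sums f w" "\<And>w. \<bar>w\<bar> < 1 \<Longrightarrow> (\<lambda>j. d j * w ^ j) sums f w"
  shows "c j = d j"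
proof -
  \<comment> \<open>The point \<open>0\<close> is excluded so that, once \<open>a 0 = 0\<close> is
    known, division by \<open>w\<close> reproduces the hypothesis for the shifted
    coefficients.\<close>
  have z: "a j = 0" if "\<And>w. 0 < \<bar>w\<bar> \<Longrightarrow> \<bar>w\<bar> < 1 \<Longrightarrow> (\<lambda>j. a j * w ^ j) sums 0" for a :: "nat \<Rightarrow> real" and j
    using that
  proof (induction j arbitrary: a)
    case (0 a)
    have "((\<lambda>_. 0) \<longlongrightarrow> a 0) (at (0::real))"
      by (rule powser_limit_0_strong[of 1]) (use 0 in auto)
    then show ?case by (simp add: tendsto_const_iff)
  next
    case (Suc j a)
    have "((\<lambda>_. 0) \<longlongrightarrow> a 0) (at (0::real))"
      by (rule powser_limit_0_strong[of 1]) (use Suc in auto)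
    then have a0: "a 0 = 0" by (simp add: tendsto_const_iff)
    show ?case
    proof (rule Suc.IH[of "\<lambda>j. a (Suc j)"])
      fix w :: real assume w: "0 < \<bar>w\<bar>" "\<bar>w\<bar> < 1"
      have "(\<lambda>j. a (Suc j) * w ^ Suc j) sums 0"
        using Suc.prems[OF w] a0 by (subst sums_Suc_iff) simp
      from sums_mult[OF this, of "1 / w"] show "(\<lambda>j. a (Suc j) * w ^ j) sums 0"
        using w by simp
    qed
  qed
  have "c j - d j = 0"
  proof (rule z[of "\<lambda>j. c j - d j"])
    fix w :: real assume "\<bar>w\<bar> < 1"
    from sums_diff[OF assms(1)[OF this] assms(2)[OF this]]
    show "(\<lambda>j. (c j - d j) * w ^ j) sums 0" by (simp add: left_diff_distrib)
  qed
  then show ?thesis by simp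
qed

lemma powser_over_coeff:
  assumes "powser_over S f" "\<And>w. \<bar>w\<bar> < 1 \<Longrightarrow> (\<lambda>j. c j * w ^ j) sums f w"
  shows "c j \<in> rat_adjoin S"
proof -
  obtain d where d: "\<forall>j. d j \<in> rat_adjoin S" "\<And>w. \<bar>w\<bar> < 1 \<Longrightarrow> (\<lambda>j. d j * w ^ j) sums f w"
    using assms(1) unfolding powser_over_def by blast
  show ?thesis using powser_unique[of c f d j] assms(2) d by auto
qed

text \<open>For \<open>k \<ge> 1\<close> this interpolates the harmonic sums of order
  \<open>k\<close>. Subtracting term by term makes the series converge even for
  \<open>k = 1\<close>, where it is the digamma function at \<open>s + 1\<close> plus Euler's
  constant.\<close>

definition zeta_diff :: "nat \<Rightarrow> real \<Rightarrow> real" where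
  "zeta_diff k s = (\<Sum>n. 1 / real (Suc n) ^ k - 1 / (real (Suc n) + s) ^ k)"

lemma summable_inverse_Suc_power: "k \<ge> 2 \<Longrightarrow> summable (\<lambda>n. 1 / real (Suc n) ^ k)"
  using inverse_power_summable[of k, where 'a = real] summable_Suc_iff[of "\<lambda>n. 1 / real n ^ k"]
  by (simp add: inverse_eq_divide)

text \<open>Induction with \<open>a ^ Suc k - b ^ Suc k = a * (a ^ k - b ^ k) + b ^ k * (a -
  b)\<close> for \<open>a = 1 / x\<close>, \<open>b = 1 / (x + s)\<close>, where
  \<open>a - b = s / (x * (x + s))\<close> is of order \<open>1 / x ^ 2\<close>.\<close>

lemma zeta_diff_bound:
  assumes "s > -1"
  shows "\<exists>C\<ge>0. \<forall>n. \<bar>1 / real (Suc n) ^ k - 1 / (real (Suc n) + s) ^ k\<bar> \<le> C * (1 / real (Suc n) ^ 2)"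
proof (induction k)
  case 0
  then show ?case by auto
next
  case (Suc k)
  then obtain C where C: "C \<ge> 0" "\<And>n. \<bar>1 / real (Suc n) ^ k - 1 / (real (Suc n) + s) ^ k\<bar> \<le> C * (1 / real (Suc n) ^ 2)"
    by blast
  \<comment> \<open>Chosen so that \<open>x + s\<close> is at least \<open>d * x\<close>, and hence
    at least \<open>d\<close>, for every \<open>x \<ge> 1\<close>.\<close>
  define d where "d = 1 + min s 0"
  have d: "0 < d" "d \<le> 1" using assms by (auto simp: d_def)
  show ?case
  proof (intro exI[of _ "C + \<bar>s\<bar> / d * (1 / d ^ k)"] conjI allI)
    show "C + \<bar>s\<bar> / d * (1 / d ^ k) \<ge> 0" using C d by auto
    fix n
    define x where "x = real (Suc n)"
    define y where "y = x + s"
    have x: "x \<ge> 1" by (simp add: x_def)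
    have "d * x \<le> x + min s 0" using mult_left_mono_neg[of 1 x "min s 0"] x by (simp add: d_def algebra_simps)
    then have yx: "d * x \<le> y" by (auto simp: y_def)
    have "d * 1 \<le> d * x" using x d by (intro mult_left_mono) auto
    then have yd: "d \<le> y" using yx by simp
    then have y: "y > 0" using d by simp
    have "1 / x ^ Suc k - 1 / y ^ Suc k = 1 / x * (1 / x ^ k - 1 / y ^ k) + 1 / y ^ k * (s / (x * y))"
      using x y by (simp add: y_def[symmetric] field_simps) (simp add: y_def algebra_simps)
    also have "\<bar>\<dots>\<bar> \<le> 1 / x * \<bar>1 / x ^ k - 1 / y ^ k\<bar> + 1 / y ^ k * (\<bar>s\<bar> / (x * y))"
      using x y by (intro order_trans[OF abs_triangle_ineq]) (simp add: abs_mult)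
    also have "\<dots> \<le> 1 * (C * (1 / x ^ 2)) + 1 / d ^ k * (\<bar>s\<bar> / (d * x ^ 2))"
    proof (intro add_mono mult_mono)
      show "\<bar>1 / x ^ k - 1 / y ^ k\<bar> \<le> C * (1 / x ^ 2)" using C(2)[of n] by (simp add: x_def y_def)
      show "1 / y ^ k \<le> 1 / d ^ k" using d yd by (intro divide_left_mono power_mono) auto
      show "\<bar>s\<bar> / (x * y) \<le> \<bar>s\<bar> / (d * x ^ 2)"
        using yx x d y by (intro divide_left_mono) (auto simp: power2_eq_square mult.left_commute)
    qed (use x y d in auto)
    also have "\<dots> = (C + \<bar>s\<bar> / d * (1 / d ^ k)) * (1 / x ^ 2)"
      using d x by (simp add: field_simps)
    finally show "\<bar>1 / real (Suc n) ^ Suc k - 1 / (real (Suc n) + s) ^ Suc k\<bar>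
        \<le> (C + \<bar>s\<bar> / d * (1 / d ^ k)) * (1 / real (Suc n) ^ 2)"
      by (simp only: x_def y_def)
  qed
qed

lemma zeta_diff_summable:
  assumes "s > -1"
  shows "summable (\<lambda>n. 1 / real (Suc n) ^ k - 1 / (real (Suc n) + s) ^ k)"
proof -
  obtain C where C: "\<And>n. \<bar>1 / real (Suc n) ^ k - 1 / (real (Suc n) + s) ^ k\<bar> \<le> C * (1 / real (Suc n) ^ 2)"
    using zeta_diff_bound[OF assms] by blast
  show ?thesis
    by (rule summable_abs_le[OF summable_mult[OF summable_inverse_Suc_power[of 2]] C]) simp
qed

lemma zeta_diff_0 [simp]: "zeta_diff k 0 = 0"
  by (simp add: zeta_diff_def)

text \<open>The series at \<open>s\<close> and at \<open>s - 1\<close> differ by an index shift, so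
  their difference telescopes.\<close>

lemma zeta_diff_diff:
  assumes "s > 0" "k \<ge> 1"
  shows "zeta_diff k s - zeta_diff k (s - 1) = 1 / s ^ k"
proof -
  let ?v = "\<lambda>n. 1 / (real n + s) ^ k"
  have "(\<lambda>n. 1 / (real n + s)) \<longlonglongrightarrow> 0"
    using assms(1) by real_asymp
  from tendsto_power[OF this, of k] have "?v \<longlonglongrightarrow> 0"
    using assms(2) by (simp add: power_divide zero_power)
  from telescope_sums'[OF this] have "(\<lambda>n. ?v n - ?v (Suc n)) sums (1 / s ^ k)" by simp
  moreover have "(\<lambda>n. (1 / real (Suc n) ^ k - 1 / (real (Suc n) + s) ^ k) -
      (1 / real (Suc n) ^ k - 1 / (real (Suc n) + (s - 1)) ^ k)) sums (zeta_diff k s - zeta_diff k (s - 1))"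
    unfolding zeta_diff_def using assms by (intro sums_diff summable_sums zeta_diff_summable) auto
  then have "(\<lambda>n. ?v n - ?v (Suc n)) sums (zeta_diff k s - zeta_diff k (s - 1))"
    by (simp add: add_ac)
  ultimately show ?thesis by (rule sums_unique2[symmetric])
qed

lemma zeta_diff_mono:
  assumes "0 \<le> s" "s \<le> t"
  shows "zeta_diff k s \<le> zeta_diff k t"
  unfolding zeta_diff_def
proof (rule suminf_le)
  fix n
  have "1 / (real (Suc n) + t) ^ k \<le> 1 / (real (Suc n) + s) ^ k"
    using assms by (intro divide_left_mono power_mono mult_pos_pos zero_less_power) auto
  then show "1 / real (Suc n) ^ k - 1 / (real (Suc n) + s) ^ k \<le> 1 / real (Suc n) ^ k - 1 / (real (Suc n) + t) ^ k"
    by simp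
  show "summable (\<lambda>n. 1 / real (Suc n) ^ k - 1 / (real (Suc n) + s) ^ k)"
    "summable (\<lambda>n. 1 / real (Suc n) ^ k - 1 / (real (Suc n) + t) ^ k)"
    using assms by (auto intro!: zeta_diff_summable simp del: of_nat_Suc)
qed

text \<open>Monotonicity bounds the increment by that over a full unit step. This includes
  \<open>k = 1\<close>, where \<open>zeta_diff\<close> itself grows without bound.\<close>

lemma zeta_diff_shift_tendsto:
  assumes "0 \<le> s" "s \<le> 1" "k \<ge> 1"
  shows "(\<lambda>K. zeta_diff k (real K + s) - zeta_diff k (real K)) \<longlonglongrightarrow> 0"
proof (rule tendsto_sandwich)
  show "\<forall>\<^sub>F K in sequentially. 0 \<le> zeta_diff k (real K + s) - zeta_diff k (real K)"
    using zeta_diff_mono[of "real K" "real K + s" k for K] assms by (intro always_eventually) auto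
  have "zeta_diff k (real K + 1) - zeta_diff k (real K) = (1 / real (Suc K)) ^ k" for K
    using zeta_diff_diff[of "real K + 1" k] assms by (simp add: power_divide add_ac)
  then show "\<forall>\<^sub>F K in sequentially. zeta_diff k (real K + s) - zeta_diff k (real K) \<le> (1 / real (Suc K)) ^ k"
    using zeta_diff_mono[of "real K + s" "real K + 1" k for K] assms
    by (intro always_eventually allI) (metis add_left_mono add_nonneg_nonneg diff_right_mono of_nat_0_le_iff)
  show "(\<lambda>K. (1 / real (Suc K)) ^ k) \<longlonglongrightarrow> 0"
    using tendsto_power[OF LIMSEQ_Suc[OF lim_1_over_n], of k] assms(3) by (simp add: zero_power power_divide)
qed simp

lemma zeta_diff_of_nat: "k \<ge> 1 \<Longrightarrow> zeta_diff k (real K) = (\<Sum>n<K. 1 / real (Suc n) ^ k)"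
proof (induction K)
  case (Suc K)
  then show ?case using zeta_diff_diff[of "real (Suc K)" k] by simp
qed simp

lemma zeta_diff_tendsto:
  assumes "0 \<le> s" "s \<le> 1" "k \<ge> 2"
  shows "(\<lambda>K. zeta_diff k (real K + s)) \<longlonglongrightarrow> riemann_zeta k"
proof -
  have "(\<lambda>K. zeta_diff k (real K)) \<longlonglongrightarrow> riemann_zeta k"
    using assms summable_LIMSEQ[OF summable_inverse_Suc_power[of k]]
    by (simp add: zeta_diff_of_nat riemann_zeta_def)
  from tendsto_add[OF this zeta_diff_shift_tendsto[OF assms(1,2), of k]] assms(3)
  show ?thesis by simp
qed

text \<open>Expand each \<open>1 / (n - w) ^ k\<close> by the binomial series and exchange the sums.
  The terms with \<open>j = 0\<close> cancel against \<open>1 / n ^ k\<close>, so only zeta values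
  at \<open>j + k \<ge> 2\<close> occur.\<close>

lemma powser_over_zeta_diff:
  assumes "k \<ge> 1"
  shows "powser_over {riemann_zeta k |k. k \<ge> 2} (\<lambda>w. zeta_diff k (- w))"
proof -
  define b where "b j = (real (k + j - 1) gchoose j)" for j
  have b_binom: "b j = real ((k + j - 1) choose j)" for j
    by (simp add: b_def binomial_gbinomial)
  have geo: "(\<lambda>j. b j * w ^ j) sums (1 / (1 - w) ^ k)" if "\<bar>w\<bar> < 1" for w :: real
  proof -
    have "(\<lambda>j. ((- real k) gchoose j) * (- w) ^ j) sums (1 + - w) powr (- real k)"
      by (rule gen_binomial_real) (use that in auto)
    also have "(\<lambda>j. ((- real k) gchoose j) * (- w) ^ j) = (\<lambda>j. b j * w ^ j)"
    proof (rule ext)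
      fix j
      have "((- real k) gchoose j) = (- 1) ^ j * b j"
        unfolding b_def using assms by (subst gbinomial_negated_upper) (simp add: of_nat_diff algebra_simps)
      then have "((- real k) gchoose j) * (- w) ^ j = ((- 1) ^ j * (- 1) ^ j) * (b j * w ^ j)"
        unfolding power_minus[of w] by (simp only: mult_ac)
      also have "(- 1) ^ j * (- 1) ^ j = (1 :: real)"
        by (simp flip: power_mult_distrib)
      finally show "((- real k) gchoose j) * (- w) ^ j = b j * w ^ j" by simp
    qed
    also have "(1 + - w) powr (- real k) = 1 / (1 - w) ^ k"
      using that by (simp add: powr_minus powr_realpow inverse_eq_divide)
    finally show ?thesis .
  qed
  define c where "c j = (if j = 0 then 0 else - b j * riemann_zeta (j + k))" for j
  have c: "c j \<in> rat_adjoin {riemann_zeta k |k. k \<ge> 2}" for j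
  proof (cases "j = 0")
    case False
    have "riemann_zeta (j + k) \<in> rat_adjoin {riemann_zeta k |k. k \<ge> 2}"
      using False assms by (intro rat_adjoin.gen) (auto intro!: exI[of _ "j + k"])
    moreover have "- b j \<in> \<rat>" unfolding b_binom by simp
    ultimately have "- b j * riemann_zeta (j + k) \<in> rat_adjoin {riemann_zeta k |k. k \<ge> 2}"
      by (intro rat_adjoin.mult[OF rat_adjoin.rat])
    then show ?thesis using False by (simp add: c_def)
  qed (simp add: c_def rat_adjoin.rat)
  have "(\<lambda>j. c j * w ^ j) sums zeta_diff k (- w)" if w: "\<bar>w\<bar> < 1" for w
  proof -
    define f where "f n j = (if j = 0 then 0 else - (b j * w ^ j) / real (Suc n) ^ (j + k))" for n j
    define B where "B = (\<Sum>j. b j * \<bar>w\<bar> ^ j)"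
    have b_nn: "b j \<ge> 0" for j by (simp add: b_binom)
    have geoB: "(\<lambda>j. b j * \<bar>w\<bar> ^ j) sums B"
      unfolding B_def using geo[of "\<bar>w\<bar>"] w by (simp add: sums_iff)
    have f_le: "\<bar>f n j\<bar> \<le> b j * \<bar>w\<bar> ^ j * (1 / real (Suc n) ^ 2)" for n j
    proof (cases "j = 0")
      case False
      have "real (Suc n) ^ 2 \<le> real (Suc n) ^ (j + k)"
        using False assms by (intro power_increasing) auto
      then have "1 / real (Suc n) ^ (j + k) \<le> 1 / real (Suc n) ^ 2"
        by (intro divide_left_mono) auto
      then have "b j * \<bar>w\<bar> ^ j * (1 / real (Suc n) ^ (j + k)) \<le> b j * \<bar>w\<bar> ^ j * (1 / real (Suc n) ^ 2)"
        using b_nn by (intro mult_left_mono) auto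
      then show ?thesis using False b_nn[of j] by (simp add: f_def abs_mult power_abs)
    qed (use b_nn in \<open>auto simp: f_def\<close>)
    have geo2: "(\<lambda>j. b j * \<bar>w\<bar> ^ j * (1 / real (Suc n) ^ 2)) sums (B * (1 / real (Suc n) ^ 2))" for n
      by (rule sums_mult2[OF geoB])
    have row: "summable (\<lambda>j. \<bar>f n j\<bar>)" for n
      by (rule summable_abs_le[OF sums_summable[OF geo2[of n]]]) (use f_le in auto)
    have tot: "summable (\<lambda>n. \<Sum>j. \<bar>f n j\<bar>)"
    proof (rule summable_abs_le)
      show "summable (\<lambda>n. B * (1 / real (Suc n) ^ 2))"
        by (rule summable_mult[OF summable_inverse_Suc_power]) simp
      fix n
      have "(\<Sum>j. \<bar>f n j\<bar>) \<le> B * (1 / real (Suc n) ^ 2)"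
        by (rule sums_le[OF f_le summable_sums[OF row] geo2])
      moreover have "0 \<le> (\<Sum>j. \<bar>f n j\<bar>)" by (intro suminf_nonneg row) simp
      ultimately show "\<bar>\<Sum>j. \<bar>f n j\<bar>\<bar> \<le> B * (1 / real (Suc n) ^ 2)" by linarith
    qed
    have rowsum: "(\<Sum>j. f n j) = 1 / real (Suc n) ^ k - 1 / (real (Suc n) + - w) ^ k" for n
    proof -
      define x where "x = real (Suc n)"
      have x: "x \<ge> 1" by (simp add: x_def)
      have wx: "\<bar>w / x\<bar> < 1" using w x by (simp add: abs_divide divide_simps)
      have "(\<lambda>j. 1 / x ^ k * (b j * (w / x) ^ j)) sums (1 / x ^ k * (1 / (1 - w / x) ^ k))"
        by (rule sums_mult[OF geo[OF wx]])
      also have "1 / x ^ k * (1 / (1 - w / x) ^ k) = 1 / (x - w) ^ k"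
        using x by (simp add: power_mult_distrib[symmetric] right_diff_distrib)
      finally have "(\<lambda>j. (if j = 0 then 1 / x ^ k else 0) - 1 / x ^ k * (b j * (w / x) ^ j)) sums (1 / x ^ k - 1 / (x - w) ^ k)"
        using sums_single[of 0 "\<lambda>_. 1 / x ^ k"] by (intro sums_diff) auto
      moreover have "(if j = 0 then 1 / x ^ k else 0) - 1 / x ^ k * (b j * (w / x) ^ j) = f n j" for j
        unfolding f_def x_def[symmetric] by (cases "j = 0") (simp_all add: power_divide power_add b_binom)
      ultimately show ?thesis by (simp add: sums_iff x_def)
    qed
    have colsum: "(\<Sum>n. f n j) = c j * w ^ j" for j
    proof (cases "j = 0")
      case False
      have "(\<lambda>n. - (b j * w ^ j) * (1 / real (Suc n) ^ (j + k))) sums (- (b j * w ^ j) * riemann_zeta (j + k))"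
        unfolding riemann_zeta_def using False assms
        by (intro sums_mult summable_sums summable_inverse_Suc_power) auto
      then show ?thesis using False by (simp add: f_def c_def sums_iff mult_ac)
    qed (simp add: f_def c_def)
    show ?thesis
      using suminf_swap(3)[OF row tot] unfolding colsum rowsum zeta_diff_def .
  qed
  then show ?thesis unfolding powser_over_def using c by blast
qed

text \<open>Newton's identities: the generating function of \<open>hom_sym d p s\<close> in \<open>p\<close> is the product over
  \<open>n \<ge> 1\<close> of \<open>(1 - z / (n + s) ^ d) / (1 - z / n ^ d)\<close>, so at integers \<open>s\<close> it is the complete
  homogeneous symmetric polynomial in \<open>1 / n ^ d\<close>, \<open>n \<le> s\<close>.\<close>

fun hom_sym :: "nat \<Rightarrow> nat \<Rightarrow> real \<Rightarrow> real" where
  "hom_sym d 0 s = 1"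
| "hom_sym d (Suc p) s = (\<Sum>k\<le>p. zeta_diff (d * Suc k) s * hom_sym d (p - k) s) / real (Suc p)"

declare hom_sym.simps(2) [simp del]

lemma hom_sym_Suc: "real (Suc p) * hom_sym d (Suc p) s = (\<Sum>k\<le>p. zeta_diff (d * Suc k) s * hom_sym d (p - k) s)"
  by (simp add: hom_sym.simps(2))

lemma hom_sym_0 [simp]: "hom_sym d (Suc p) 0 = 0"
  by (simp add: hom_sym.simps(2))

text \<open>Passing from \<open>s\<close> to \<open>s - 1\<close> multiplies the generating function
  by \<open>1 - z / s ^ d\<close>. The proof checks that the right-hand side \<open>E\<close>
  satisfies Newton's identities for the power sums at \<open>s - 1\<close>.\<close>

lemma hom_sym_diff:
  assumes s: "s > 0" and d: "d \<ge> 1"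
  shows "hom_sym d p (s - 1) = hom_sym d p s - 1 / s ^ d * (if p = 0 then 0 else hom_sym d (p - 1) s)"
proof (induction p rule: less_induct)
  case (less p)
  define y where "y = 1 / s ^ d"
  define H' where "H' q = (if q = 0 then 0 else hom_sym d (q - 1) s)" for q
  define E where "E q = hom_sym d q s - y * H' q" for q
  have IH: "hom_sym d q (s - 1) = E q" if "q < p" for q
    using less[OF that] by (simp add: E_def y_def H'_def)
  have tau: "zeta_diff (d * Suc k) (s - 1) = zeta_diff (d * Suc k) s - y ^ Suc k" for k
    using zeta_diff_diff[OF s, of "d * Suc k"] d
    by (simp only: y_def power_divide power_one flip: power_mult) (simp add: Suc_le_eq)
  \<comment> \<open>Convolution with a geometric sequence cancels the factor \<open>1 - y z\<close>
    in the generating function of \<open>E\<close>.\<close>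
  have tele: "(\<Sum>k\<le>q. y ^ Suc k * E (q - k)) = y * hom_sym d q s" for q
  proof (induction q)
    case (Suc q)
    have "(\<Sum>k\<le>Suc q. y ^ Suc k * E (Suc q - k)) = y * E (Suc q) + y * (\<Sum>k\<le>q. y ^ Suc k * E (q - k))"
      by (subst sum.atMost_Suc_shift) (simp add: sum_distrib_left mult_ac)
    also have "\<dots> = y * hom_sym d (Suc q) s"
      by (simp only: Suc) (simp add: E_def H'_def algebra_simps)
    finally show ?case .
  qed (simp add: E_def H'_def)
  show ?case
  proof (cases p)
    case (Suc q)
    \<comment> \<open>Newton's identity one index lower, \<open>H'\<close> being the shifted
      sequence.\<close>
    have sH': "(\<Sum>k\<le>q. zeta_diff (d * Suc k) s * H' (q - k)) = real q * hom_sym d q s"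
    proof (cases q)
      case (Suc r)
      have "(\<Sum>k\<le>q. zeta_diff (d * Suc k) s * H' (q - k)) = (\<Sum>k\<le>r. zeta_diff (d * Suc k) s * hom_sym d (r - k) s)"
        unfolding Suc by (simp add: H'_def Suc_diff_le)
      then show ?thesis using hom_sym_Suc[of r d s] Suc by simp
    qed (simp add: H'_def)
    have "real (Suc q) * hom_sym d (Suc q) (s - 1) = (\<Sum>k\<le>q. (zeta_diff (d * Suc k) s - y ^ Suc k) * E (q - k))"
      unfolding hom_sym_Suc tau using Suc by (intro sum.cong) (auto simp: IH)
    also have "\<dots> = (\<Sum>k\<le>q. zeta_diff (d * Suc k) s * hom_sym d (q - k) s)
        - y * (\<Sum>k\<le>q. zeta_diff (d * Suc k) s * H' (q - k)) - (\<Sum>k\<le>q. y ^ Suc k * E (q - k))"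
    proof -
      have "(zeta_diff (d * Suc k) s - y ^ Suc k) * E (q - k) = zeta_diff (d * Suc k) s * hom_sym d (q - k) s
          - y * (zeta_diff (d * Suc k) s * H' (q - k)) - y ^ Suc k * E (q - k)" for k
        unfolding E_def[of "q - k"] left_diff_distrib by (simp add: right_diff_distrib mult.left_commute)
      then show ?thesis by (simp only: sum_subtractf sum_distrib_left)
    qed
    also have "\<dots> = real (Suc q) * hom_sym d (Suc q) s - y * (real q * hom_sym d q s) - y * hom_sym d q s"
      by (simp only: sH' tele hom_sym_Suc)
    also have "\<dots> = real (Suc q) * (hom_sym d (Suc q) s - y * hom_sym d q s)"
      by (simp add: algebra_simps)
    finally have "hom_sym d (Suc q) (s - 1) = hom_sym d (Suc q) s - y * hom_sym d q s"
      unfolding mult_cancel_left by simp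
    then show ?thesis by (simp add: Suc y_def)
  qed simp
qed

text \<open>The limit is the same for all shifts \<open>s\<close>, because this holds for every
  \<open>zeta_diff\<close> involved: their orders are multiples of \<open>d\<close>, hence at least
  \<open>2\<close>.\<close>

lemma hom_sym_tendsto:
  assumes "d \<ge> 2"
  shows "\<exists>L. \<forall>s. 0 \<le> s \<longrightarrow> s \<le> 1 \<longrightarrow> (\<lambda>K. hom_sym d p (real K + s)) \<longlonglongrightarrow> L"
proof (induction p rule: less_induct)
  case (less p)
  show ?case
  proof (cases p)
    case (Suc q)
    have "\<forall>r\<le>q. \<exists>L. \<forall>s. 0 \<le> s \<longrightarrow> s \<le> 1 \<longrightarrow> (\<lambda>K. hom_sym d r (real K + s)) \<longlonglongrightarrow> L"
      using less Suc by auto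
    then obtain L where L: "\<And>r s. r \<le> q \<Longrightarrow> 0 \<le> s \<Longrightarrow> s \<le> 1 \<Longrightarrow> (\<lambda>K. hom_sym d r (real K + s)) \<longlonglongrightarrow> L r"
      by metis
    show ?thesis unfolding Suc hom_sym.simps(2)
    proof (intro exI[of _ "(\<Sum>k\<le>q. riemann_zeta (d * Suc k) * L (q - k)) / real (Suc q)"] allI impI
        tendsto_divide tendsto_sum tendsto_mult tendsto_const)
      fix s :: real and k assume "0 \<le> s" "s \<le> 1" "k \<in> {..q}"
      then show "(\<lambda>K. hom_sym d (q - k) (real K + s)) \<longlonglongrightarrow> L (q - k)"
        by (intro L) auto
      have "2 \<le> d * Suc k" using assms by (metis mult_le_mono mult.right_neutral Suc_le_mono le0 One_nat_def)
      then show "(\<lambda>K. zeta_diff (d * Suc k) (real K + s)) \<longlonglongrightarrow> riemann_zeta (d * Suc k)"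
        using \<open>0 \<le> s\<close> \<open>s \<le> 1\<close> by (intro zeta_diff_tendsto)
    qed simp
  qed auto
qed

lemma powser_over_hom_sym:
  assumes "d \<ge> 1"
  shows "powser_over {riemann_zeta k |k. k \<ge> 2} (\<lambda>w. hom_sym d p (- w))"
proof (induction p rule: less_induct)
  case (less p)
  show ?case
  proof (cases p)
    case 0
    then show ?thesis by (simp add: powser_over_const rat_adjoin.rat)
  next
    case (Suc q)
    have "powser_over {riemann_zeta k |k. k \<ge> 2}
       (\<lambda>w. 1 / real (Suc q) * (\<Sum>k\<le>q. zeta_diff (d * Suc k) (- w) * hom_sym d (q - k) (- w)))"
      using less Suc assms
      by (intro powser_over_cmult powser_over_sum powser_over_mult powser_over_zeta_diff) (auto intro!: rat_adjoin.rat simp: Suc_le_eq)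
    then show ?thesis by (simp add: Suc hom_sym.simps(2))
  qed
qed

text \<open>By periodicity \<open>f (real K + s) - f (real K)\<close> does not depend on
  \<open>K\<close>, so it equals its limit \<open>0\<close>. One more period reaches the arguments
  between \<open>-1\<close> and \<open>0\<close>.\<close>

lemma periodic_const:
  fixes f :: "real \<Rightarrow> real"
  assumes per: "\<And>s. s > 0 \<Longrightarrow> f s = f (s - 1)"
    and lim: "\<And>s. 0 \<le> s \<Longrightarrow> s \<le> 1 \<Longrightarrow> (\<lambda>K. f (real K + s) - f (real K)) \<longlonglongrightarrow> 0"
    and s: "s > -1"
  shows "f s = f 0"
proof -
  have shift: "f (real K + u) = f u" if "u > -1" for u K
  proof (induction K)
    case (Suc K)
    then show ?case using per[of "real (Suc K) + u"] that by (simp add: algebra_simps)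
  qed simp
  have c: "f u = f 0" if "0 \<le> u" "u \<le> 1" for u
    using lim[OF that] shift[of u] shift[of 0] that by (simp add: LIMSEQ_const_iff)
  have "f u = f 0" if u: "u \<ge> 0" for u
  proof -
    obtain K where K: "real K \<le> u" "u < real K + 1"
      using u by (metis floor_of_nat of_int_of_nat_eq real_of_int_floor_add_one_gt of_int_floor_le zero_le_floor nonneg_int_cases)
    then have "f (real K + (u - real K)) = f (u - real K)" by (intro shift) auto
    then show ?thesis using c[of "u - real K"] K by simp
  qed
  from this[of "s + 1"] show ?thesis using per[of "s + 1"] s by simp
qed

section \<open>The Newton series attached to the star sums\<close>

text \<open>For \<open>p \<ge> 1\<close> this is the sequence \<open>a\<^sub>n\<close> belonging to
  \<open>p\<close>, with \<open>n = i + 1\<close>; see \<open>star_seq_eq_mzs_star\<close>.\<close>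

primrec star_seq :: "nat \<Rightarrow> nat \<Rightarrow> nat \<Rightarrow> real" where
  "star_seq m 0 = (\<lambda>_. 1)"
| "star_seq m (Suc p) = (average ^^ m) (div_Suc (star_seq m p))"

declare star_seq.simps(2) [simp del]

lemma admissible_average_funpow: "admissible (div_Suc \<eta>) \<Longrightarrow> admissible (div_Suc ((average ^^ m) \<eta>))"
  by (induction m) (auto intro: admissible_average)

lemma admissible_div_Suc_star_seq: "admissible (div_Suc (star_seq m (Suc p)))"
  unfolding star_seq.simps(2)
proof (rule admissible_average_funpow, induction p)
  case 0
  show ?case by (simp add: admissible_inverse_squares)
next
  case (Suc p)
  then show ?case by (simp only: star_seq.simps(2) admissible_div_Suc admissible_average_funpow)
qed

lemma admissible_div_Suc_div_Suc_star_seq: "admissible (div_Suc (div_Suc (star_seq m p)))"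
  by (cases p) (use admissible_div_Suc[OF admissible_div_Suc_star_seq] admissible_inverse_squares in auto)

lemma completely_monotone_star_seq: "completely_monotone (star_seq m p)"
proof (induction p)
  case (Suc p)
  have "completely_monotone ((average ^^ k) (div_Suc (star_seq m p)))" for k
    by (induction k) (auto intro: completely_monotone_average completely_monotone_div_Suc Suc)
  then show ?case by (simp add: star_seq.simps(2))
qed (simp add: completely_monotone_const)

lemma newton_sum_average_funpow:
  "admissible (div_Suc \<eta>) \<Longrightarrow> s > 0 \<Longrightarrow> newton_sum ((average ^^ m) \<eta>) s = newton_sum \<eta> s / s ^ m"
  by (induction m) (simp_all add: newton_sum_average admissible_average_funpow)

text \<open>Both sides vanish at \<open>0\<close>, have backward difference
  \<open>hom_sym (Suc m) p u / u ^ Suc m\<close>, and have increments over shifts in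
  \<open>[0, 1]\<close> that tend to \<open>0\<close> at infinity; so \<open>periodic_const\<close>
  applies to their difference.\<close>

lemma newton_star_seq_eq_hom_sym:
  assumes "m \<ge> 1" "s > -1"
  shows "s * newton_sum (div_Suc (star_seq m (Suc p))) s = hom_sym (Suc m) (Suc p) s"
  using assms(2)
proof (induction p arbitrary: s rule: less_induct)
  case (less p s)
  define N where "N s = s * newton_sum (div_Suc (star_seq m (Suc p))) s" for s
  \<comment> \<open>For \<open>p = 0\<close> the coefficients are those of \<open>1 / u\<close>,
    which replaces the induction hypothesis.\<close>
  have prev: "newton_sum (div_Suc (star_seq m p)) u = hom_sym (Suc m) p u / u" if "u > 0" for u
  proof (cases p)
    case 0
    then show ?thesis using newton_sum_div_Suc_one[OF that] by simp
  next
    case (Suc q)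
    then show ?thesis using less.IH[of q u] that by (simp add: field_simps)
  qed
  have N_diff: "N u - N (u - 1) = 1 / u ^ Suc m * hom_sym (Suc m) p u" if "u > 0" for u
    unfolding N_def newton_sum_div_Suc_diff(2)[OF admissible_div_Suc_star_seq that]
    using newton_sum_average_funpow[OF admissible_div_Suc_div_Suc_star_seq that, of m m p] prev[OF that]
    by (simp add: star_seq.simps(2))
  have H_diff: "hom_sym (Suc m) (Suc p) u - hom_sym (Suc m) (Suc p) (u - 1) = 1 / u ^ Suc m * hom_sym (Suc m) p u" if "u > 0" for u
    using hom_sym_diff[OF that, of "Suc m" "Suc p"] by simp
  obtain L where L: "\<And>u. 0 \<le> u \<Longrightarrow> u \<le> 1 \<Longrightarrow> (\<lambda>K. hom_sym (Suc m) (Suc p) (real K + u)) \<longlonglongrightarrow> L"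
    using hom_sym_tendsto[of "Suc m" "Suc p"] assms(1) by auto
  obtain L' where L': "\<And>u. 0 \<le> u \<Longrightarrow> u \<le> 1 \<Longrightarrow> (\<lambda>K. hom_sym (Suc m) p (real K + u)) \<longlonglongrightarrow> L'"
    using hom_sym_tendsto[of "Suc m" p] assms(1) by auto
  \<comment> \<open>Along integers the difference equation alone makes the increments of
    \<open>N\<close> small; complete monotonicity of the coefficients then covers real
    shifts.\<close>
  have "(\<lambda>K. (1 / real (Suc K)) ^ Suc m * hom_sym (Suc m) p (real K + 1)) \<longlonglongrightarrow> 0 ^ Suc m * L'"
    by (intro tendsto_mult tendsto_power LIMSEQ_Suc[OF lim_1_over_n] L') auto
  moreover have "N (real (Suc K)) - N (real K) = (1 / real (Suc K)) ^ Suc m * hom_sym (Suc m) p (real K + 1)" for K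
    using N_diff[of "real K + 1"] by (simp add: power_divide add.commute)
  ultimately have "(\<lambda>K. N (real (Suc K)) - N (real K)) \<longlonglongrightarrow> 0"
    by simp
  then have N_shift: "(\<lambda>K. N (real K + u) - N (real K)) \<longlonglongrightarrow> 0" if "0 \<le> u" "u \<le> 1" for u
    unfolding N_def using that
    by (intro newton_sum_shift_tendsto completely_monotone_div_Suc completely_monotone_star_seq admissible_summable admissible_div_Suc_star_seq)
  have "N s - hom_sym (Suc m) (Suc p) s = N 0 - hom_sym (Suc m) (Suc p) 0"
  proof (rule periodic_const[OF _ _ less.prems])
    fix u :: real assume "u > 0"
    then show "N u - hom_sym (Suc m) (Suc p) u = N (u - 1) - hom_sym (Suc m) (Suc p) (u - 1)"
      using N_diff[of u] H_diff[of u] by simp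
  next
    fix u :: real assume u: "0 \<le> u" "u \<le> 1"
    have "(\<lambda>K. (N (real K + u) - N (real K)) - (hom_sym (Suc m) (Suc p) (real K + u) - hom_sym (Suc m) (Suc p) (real K + 0))) \<longlonglongrightarrow> 0 - (L - L)"
      using u by (intro tendsto_diff N_shift L) auto
    then show "(\<lambda>K. N (real K + u) - hom_sym (Suc m) (Suc p) (real K + u) - (N (real K) - hom_sym (Suc m) (Suc p) (real K))) \<longlonglongrightarrow> 0"
      by (simp add: algebra_simps)
  qed
  then show ?case
    by (simp add: N_def)
qed

section \<open>Series weighted by multiple harmonic sums as Taylor coefficients of Newton
  series\<close>

abbreviation zeta_values :: "real set" where
  "zeta_values \<equiv> {riemann_zeta k |k. k \<ge> 2}"

text \<open>The bound passes along the index: by \<open>newton_poly_eq_sum\<close>, summing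
  \<open>newton_poly j (- (1/2)) / Suc j\<close> over \<open>j < l\<close> gives at most twice
  \<open>newton_poly l (- (1/2))\<close>.\<close>

lemma mzs_dominated:
  assumes "\<forall>k\<in>set ks. k \<ge> 1"
  shows "\<exists>C. \<forall>l. \<bar>mzs l ks\<bar> \<le> C * newton_poly l (- (1/2))"
  using assms
proof (induction ks)
  case Nil
  then show ?case using newton_poly_neg_ge_one[of "1/2"] by (intro exI[of _ 1]) simp
next
  case (Cons k ks)
  then obtain C where C: "\<And>l. \<bar>mzs l ks\<bar> \<le> C * newton_poly l (- (1/2))" by auto
  have C0: "C \<ge> 0" using C[of 0] mzs_nonneg[of 0 ks] by simp
  have "\<bar>mzs l (k # ks)\<bar> \<le> 2 * C * newton_poly l (- (1/2))" for l
  proof -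
    have "mzs j ks / real (Suc j) ^ k \<le> C * (newton_poly j (- (1/2)) / real (Suc j))" for j
    proof -
      have "real (Suc j) ^ 1 \<le> real (Suc j) ^ k"
        using Cons.prems by (intro power_increasing) auto
      then have "mzs j ks / real (Suc j) ^ k \<le> mzs j ks / real (Suc j)"
        using mzs_nonneg by (intro divide_left_mono) auto
      also have "\<dots> \<le> C * newton_poly j (- (1/2)) / real (Suc j)"
        using C[of j] by (intro divide_right_mono) auto
      finally show ?thesis by simp
    qed
    then have "mzs l (k # ks) \<le> C * (\<Sum>j<l. newton_poly j (- (1/2)) / real (Suc j))"
      unfolding mzs_Cons sum_distrib_left by (intro sum_mono) auto
    also have "(\<Sum>j<l. newton_poly j (- (1/2)) / real (Suc j)) \<le> 2 * newton_poly l (- (1/2))"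
      using newton_poly_eq_sum[of l "- (1/2)"] by simp
    finally show ?thesis using C0 mzs_nonneg[of l "k # ks"] by (simp add: mult_left_mono)
  qed
  then show ?case by blast
qed

lemma summable_mzs:
  assumes "admissible \<eta>" "\<forall>k\<in>set ks. k \<ge> 1"
  shows "summable (\<lambda>i. \<eta> i * mzs i ks)"
proof -
  obtain C where C: "\<And>l. \<bar>mzs l ks\<bar> \<le> C * newton_poly l (- (1/2))"
    using mzs_dominated[OF assms(2)] by blast
  show ?thesis
  proof (rule summable_abs_le)
    show "summable (\<lambda>i. C * (\<eta> i * newton_poly i (- (1/2))))"
      by (intro summable_mult admissible_summableD assms) auto
    show "\<bar>\<eta> i * mzs i ks\<bar> \<le> C * (\<eta> i * newton_poly i (- (1/2)))" for i
      using mult_left_mono[OF C[of i] admissible_nonneg[OF assms(1), of i]] admissible_nonneg[OF assms(1), of i]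
      by (simp add: abs_mult mult.left_commute)
  qed
qed

text \<open>Exchanges \<open>i\<close> with the outermost variable of \<open>mzs\<close>. One factor
  \<open>1 / Suc l\<close> is absorbed by \<open>div_Suc\<close>, the other \<open>k\<close>
  remain.\<close>

lemma suminf_mzs_Cons:
  assumes "admissible \<eta>" "\<forall>k\<in>set ks. k \<ge> 1"
  shows "(\<Sum>i. \<eta> i * mzs i (Suc k # ks)) = (\<Sum>l. div_Suc (tail_sum \<eta>) l * (mzs l ks / real (Suc l) ^ k))"
proof -
  obtain C where C: "\<And>l. \<bar>mzs l ks\<bar> \<le> C * newton_poly l (- (1/2))"
    using mzs_dominated[OF assms(2)] by blast
  have "\<bar>mzs l ks / real (Suc l) ^ k\<bar> \<le> C * newton_poly l (- (1/2))" for l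
  proof -
    have "\<bar>mzs l ks / real (Suc l) ^ k\<bar> \<le> \<bar>mzs l ks\<bar> / 1"
      unfolding abs_divide by (intro divide_left_mono) auto
    then show ?thesis using C[of l] by simp
  qed
  from tail_sum_swap(2)[OF assms(1) _ _ this] show ?thesis
    by (simp add: sums_iff mzs_Cons mult.commute)
qed

abbreviation tail_sums :: "(nat \<Rightarrow> real) \<Rightarrow> nat \<Rightarrow> nat \<Rightarrow> real" where
  "tail_sums \<eta> i \<equiv> ((\<lambda>\<theta>. div_Suc (tail_sum \<theta>)) ^^ i) \<eta>"

lemma admissible_tail_sums: "admissible \<eta> \<Longrightarrow> admissible (tail_sums \<eta> i)"
  by (induction i) (auto intro: admissible_tail_sum)

lemma completely_monotone_tail_sums: "admissible \<eta> \<Longrightarrow> completely_monotone \<eta> \<Longrightarrow> completely_monotone (tail_sums \<eta> i)"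
  by (induction i) (auto intro: completely_monotone_div_Suc completely_monotone_tail_sum admissible_tail_sums)

lemma suminf_mzs_ones:
  assumes "admissible \<eta>" "\<forall>k\<in>set ks. k \<ge> 1"
  shows "(\<Sum>i. \<eta> i * mzs i (rep a [1] @ ks)) = (\<Sum>l. tail_sums \<eta> a l * mzs l ks)"
  using assms(2)
proof (induction a arbitrary: ks)
  case (Suc a)
  have comm: "rep (Suc a) [1] @ ks = rep a [1] @ (1 # ks)"
    by (induction a) auto
  show ?case
    unfolding comm using Suc.prems suminf_mzs_Cons[OF admissible_tail_sums[OF assms(1)] Suc.prems, of a 0]
    by (subst Suc.IH) simp_all
qed simp

text \<open>Insert \<open>newton_poly_mzs\<close> and exchange the sums; since \<open>mzs\<close> is
  nonnegative, the absolute values form the same series at \<open>\<bar>w\<bar>\<close>, which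
  admissibility controls.\<close>

lemma newton_sum_powser:
  assumes "admissible \<eta>" "\<bar>w\<bar> < 1"
  shows "(\<lambda>b. (\<Sum>i. \<eta> i * mzs i (rep b [1])) * w ^ b) sums newton_sum \<eta> (- w)"
proof -
  define f where "f i b = \<eta> i * (mzs i (rep b [1]) * w ^ b)" for i b
  have row: "(\<lambda>b. f i b) sums (\<eta> i * newton_poly i (- w))" for i
    unfolding f_def by (intro sums_mult newton_poly_mzs)
  have abs: "(\<lambda>b. \<bar>f i b\<bar>) sums (\<eta> i * newton_poly i (- \<bar>w\<bar>))" for i
    using sums_mult[OF newton_poly_mzs[of i "\<bar>w\<bar>"], of "\<eta> i"] admissible_nonneg[OF assms(1), of i]
    by (simp add: f_def abs_mult power_abs mzs_nonneg)
  have tot: "summable (\<lambda>i. \<Sum>b. \<bar>f i b\<bar>)"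
    using sums_summable[OF admissible_sums[OF assms(1), of "- \<bar>w\<bar>"]] assms(2) abs by (simp add: sums_iff)
  have "(\<Sum>i. f i b) = (\<Sum>i. \<eta> i * mzs i (rep b [1])) * w ^ b" for b
  proof -
    have "summable (\<lambda>i. \<eta> i * mzs i (rep b [1]))"
      by (rule summable_mzs[OF assms(1)]) (auto simp: rep_def)
    from suminf_mult2[OF this, of "w ^ b"] show ?thesis by (simp add: f_def mult.assoc)
  qed
  moreover have "(\<Sum>b. f i b) = \<eta> i * newton_poly i (- w)" for i
    using row[of i] by (simp add: sums_iff)
  ultimately show ?thesis
    using suminf_swap(3)[OF sums_summable[OF abs] tot] by (simp add: newton_sum_def)
qed

text \<open>Taylor's formula at \<open>0\<close> with remainder, by iterating
  \<open>newton_sum_tail_sum\<close>.\<close>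

lemma newton_sum_expansion:
  assumes "admissible \<eta>" "s > -1"
  shows "newton_sum \<eta> s = (\<Sum>i<m. (- s) ^ i * suminf (tail_sums \<eta> i)) + (- s) ^ m * newton_sum (tail_sums \<eta> m) s"
proof (induction m)
  case (Suc m)
  have e: "newton_sum (tail_sums \<eta> m) s = suminf (tail_sums \<eta> m) - s * newton_sum (tail_sums \<eta> (Suc m)) s"
    using newton_sum_tail_sum[OF admissible_tail_sums[OF assms(1)] assms(2), of m] by simp
  show ?case
    by (simp only: Suc e sum.lessThan_Suc power_Suc) (simp add: algebra_simps)
qed simp

text \<open>The extra factor \<open>w\<close> is there because the closed forms describe
  \<open>s * newton_sum \<eta> s\<close>; the wanted sum is therefore the coefficient of order
  \<open>b + 1\<close>.\<close>

lemma powser_over_coeff_mult: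
  assumes "powser_over S (\<lambda>w. w * newton_sum \<eta> (- w))" "admissible \<eta>"
  shows "(\<Sum>i. \<eta> i * mzs i (rep b [1])) \<in> rat_adjoin S"
proof -
  define c where "c j = (if j = 0 then 0 else \<Sum>i. \<eta> i * mzs i (rep (j - 1) [1]))" for j
  have "(\<lambda>j. c j * w ^ j) sums (w * newton_sum \<eta> (- w))" if "\<bar>w\<bar> < 1" for w
  proof -
    have "(\<lambda>j. c (Suc j) * w ^ Suc j) sums (w * newton_sum \<eta> (- w))"
      using sums_mult[OF newton_sum_powser[OF assms(2) that], of w] by (simp add: c_def mult_ac)
    from sums_Suc[OF this] show ?thesis by (simp add: c_def)
  qed
  from powser_over_coeff[OF assms(1) this, of "Suc b"] show ?thesis by (simp add: c_def)
qed

text \<open>By \<open>suminf_mzs_ones\<close> with the empty index these are, up to sign, the Taylor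
  coefficients of \<open>hom_sym (Suc m) (Suc p)\<close> at \<open>0\<close>.\<close>

lemma suminf_tail_sums_in_zeta_ring:
  assumes "m \<ge> 1"
  shows "suminf (tail_sums (div_Suc (star_seq m (Suc p))) i) \<in> rat_adjoin zeta_values"
proof -
  let ?\<eta> = "div_Suc (star_seq m (Suc p))"
  have "powser_over zeta_values (\<lambda>w. - 1 * hom_sym (Suc m) (Suc p) (- w))"
    by (intro powser_over_cmult powser_over_hom_sym rat_adjoin.rat) auto
  moreover have "- 1 * hom_sym (Suc m) (Suc p) (- w) = w * newton_sum ?\<eta> (- w)" if "\<bar>w\<bar> < 1" for w
  proof -
    have "- w > -1" using that by auto
    from newton_star_seq_eq_hom_sym[OF assms this, of p] show ?thesis by simp
  qed
  ultimately have "powser_over zeta_values (\<lambda>w. w * newton_sum ?\<eta> (- w))"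
    unfolding powser_over_def by auto
  then have "(\<Sum>l. ?\<eta> l * mzs l (rep i [1])) \<in> rat_adjoin zeta_values"
    by (intro powser_over_coeff_mult admissible_div_Suc_star_seq) auto
  then show ?thesis using suminf_mzs_ones[OF admissible_div_Suc_star_seq, of "[]" m p i] by simp
qed

text \<open>Both sides solve the same difference equation; the sum over \<open>i\<close> accounts for the Taylor
  polynomial of degree \<open>m\<close> of \<open>hom_sym (Suc m) (Suc p)\<close>, divided by \<open>s ^ (m + 1)\<close>.\<close>

lemma newton_tail_sums_eq:
  assumes m: "m \<ge> 1" and "s > -1"
  shows "s * newton_sum (div_Suc (tail_sums (div_Suc (star_seq m (Suc p))) m)) s =
    (- 1) ^ m * (hom_sym (Suc m) (Suc (Suc p)) s
      - (\<Sum>i<m. (- 1) ^ i * suminf (tail_sums (div_Suc (star_seq m (Suc p))) i) * zeta_diff (m - i) s))"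
proof -
  \<comment> \<open>\<open>\<kappa> i\<close> is the Taylor coefficient of order
    \<open>i + 1\<close> of \<open>hom_sym (Suc m) (Suc p)\<close> at \<open>0\<close>, and
    \<open>(- 1) ^ m * newton_sum \<gamma>\<close> is the function \<open>\<rho>\<close>.\<close>
  define \<gamma> where "\<gamma> = tail_sums (div_Suc (star_seq m (Suc p))) m"
  define \<kappa> where "\<kappa> i = (- 1) ^ i * suminf (tail_sums (div_Suc (star_seq m (Suc p))) i)" for i
  define F where "F s = s * newton_sum (div_Suc \<gamma>) s" for s
  define G where "G s = (- 1) ^ m * (hom_sym (Suc m) (Suc (Suc p)) s - (\<Sum>i<m. \<kappa> i * zeta_diff (m - i) s))" for s
  have w\<gamma>: "admissible \<gamma>" unfolding \<gamma>_def by (intro admissible_tail_sums admissible_div_Suc_star_seq)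
  have c\<gamma>: "completely_monotone \<gamma>" unfolding \<gamma>_def by (intro completely_monotone_tail_sums admissible_div_Suc_star_seq completely_monotone_div_Suc completely_monotone_star_seq)
  \<comment> \<open>Division by \<open>u ^ Suc m\<close> turns the Taylor terms into
    \<open>\<kappa> i / u ^ (m - i)\<close>, which are the differences of
    \<open>zeta_diff (m - i)\<close>.\<close>
  have F_diff: "F u - F (u - 1) = (- 1) ^ m * (1 / u ^ Suc m * hom_sym (Suc m) (Suc p) u - (\<Sum>i<m. \<kappa> i * (1 / u ^ (m - i))))"
    if u: "u > 0" for u
  proof -
    have "hom_sym (Suc m) (Suc p) u = u * ((\<Sum>i<m. \<kappa> i * u ^ i) + (- u) ^ m * newton_sum \<gamma> u)"
      using newton_sum_expansion[OF admissible_div_Suc_star_seq, of u m p m] newton_star_seq_eq_hom_sym[OF m, of u p] u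
      by (simp add: \<kappa>_def \<gamma>_def power_minus[of u] mult_ac)
    also have "\<dots> = u ^ Suc m * ((\<Sum>i<m. \<kappa> i * (1 / u ^ (m - i))) + (- 1) ^ m * newton_sum \<gamma> u)"
    proof -
      have "u ^ i = u ^ m * (1 / u ^ (m - i))" if "i < m" for i
        using that u power_add[of u i "m - i"] by simp
      then have "(\<Sum>i<m. \<kappa> i * u ^ i) = u ^ m * (\<Sum>i<m. \<kappa> i * (1 / u ^ (m - i)))"
        unfolding sum_distrib_left by (intro sum.cong) auto
      then show ?thesis by (simp add: power_minus[of u] algebra_simps)
    qed
    finally have "1 / u ^ Suc m * hom_sym (Suc m) (Suc p) u - (\<Sum>i<m. \<kappa> i * (1 / u ^ (m - i))) = (- 1) ^ m * newton_sum \<gamma> u"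
      using u by simp
    moreover have "F u - F (u - 1) = newton_sum \<gamma> u"
      unfolding F_def by (rule newton_sum_div_Suc_diff(2)[OF admissible_div_Suc[OF w\<gamma>] u])
    ultimately show ?thesis by (simp add: mult.assoc[symmetric] power_mult_distrib[symmetric])
  qed
  have G_diff: "G u - G (u - 1) = (- 1) ^ m * (1 / u ^ Suc m * hom_sym (Suc m) (Suc p) u - (\<Sum>i<m. \<kappa> i * (1 / u ^ (m - i))))"
    if u: "u > 0" for u
  proof -
    have "hom_sym (Suc m) (Suc (Suc p)) u - hom_sym (Suc m) (Suc (Suc p)) (u - 1) = 1 / u ^ Suc m * hom_sym (Suc m) (Suc p) u"
      using hom_sym_diff[OF u, of "Suc m" "Suc (Suc p)"] by simp
    moreover have "(\<Sum>i<m. \<kappa> i * zeta_diff (m - i) u) - (\<Sum>i<m. \<kappa> i * zeta_diff (m - i) (u - 1)) = (\<Sum>i<m. \<kappa> i * (1 / u ^ (m - i)))"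
      unfolding sum_subtractf[symmetric] right_diff_distrib[symmetric] using u
      by (intro sum.cong refl) (subst zeta_diff_diff, auto)
    moreover have "G u - G (u - 1) = (- 1) ^ m * ((hom_sym (Suc m) (Suc (Suc p)) u - hom_sym (Suc m) (Suc (Suc p)) (u - 1))
        - ((\<Sum>i<m. \<kappa> i * zeta_diff (m - i) u) - (\<Sum>i<m. \<kappa> i * zeta_diff (m - i) (u - 1))))"
      by (simp add: G_def algebra_simps)
    ultimately show ?thesis by simp
  qed
  obtain L where L: "\<And>u. 0 \<le> u \<Longrightarrow> u \<le> 1 \<Longrightarrow> (\<lambda>K. hom_sym (Suc m) (Suc (Suc p)) (real K + u)) \<longlonglongrightarrow> L"
    using hom_sym_tendsto[of "Suc m" "Suc (Suc p)"] m by auto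
  obtain L' where L': "\<And>u. 0 \<le> u \<Longrightarrow> u \<le> 1 \<Longrightarrow> (\<lambda>K. hom_sym (Suc m) (Suc p) (real K + u)) \<longlonglongrightarrow> L'"
    using hom_sym_tendsto[of "Suc m" "Suc p"] m by auto
  have "(\<lambda>K. (- 1) ^ m * ((1 / real (Suc K)) ^ Suc m * hom_sym (Suc m) (Suc p) (real K + 1)
      - (\<Sum>i<m. \<kappa> i * (1 / real (Suc K)) ^ (m - i)))) \<longlonglongrightarrow> (- 1) ^ m * (0 ^ Suc m * L' - (\<Sum>i<m. \<kappa> i * 0 ^ (m - i)))"
    by (intro tendsto_mult tendsto_diff tendsto_sum tendsto_const tendsto_power LIMSEQ_Suc[OF lim_1_over_n] L') auto
  moreover have "F (real (Suc K)) - F (real K) = (- 1) ^ m * ((1 / real (Suc K)) ^ Suc m * hom_sym (Suc m) (Suc p) (real K + 1)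
      - (\<Sum>i<m. \<kappa> i * (1 / real (Suc K)) ^ (m - i)))" for K
    using F_diff[of "real K + 1"] by (simp add: power_divide add.commute)
  ultimately have "(\<lambda>K. F (real (Suc K)) - F (real K)) \<longlonglongrightarrow> 0"
    by (simp add: zero_power)
  then have F_shift: "(\<lambda>K. F (real K + u) - F (real K)) \<longlonglongrightarrow> 0" if "0 \<le> u" "u \<le> 1" for u
    unfolding F_def using that
    by (intro newton_sum_shift_tendsto completely_monotone_div_Suc c\<gamma> admissible_summable admissible_div_Suc w\<gamma>)
  \<comment> \<open>Only increments are compared, because the summand with \<open>m - i = 1\<close>
    contains \<open>zeta_diff 1\<close>, which has no limit.\<close>
  have G_shift: "(\<lambda>K. G (real K + u) - G (real K)) \<longlonglongrightarrow> 0" if "0 \<le> u" "u \<le> 1" for u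
  proof -
    have "(\<lambda>K. (- 1) ^ m * ((hom_sym (Suc m) (Suc (Suc p)) (real K + u) - hom_sym (Suc m) (Suc (Suc p)) (real K + 0))
        - (\<Sum>i<m. \<kappa> i * (zeta_diff (m - i) (real K + u) - zeta_diff (m - i) (real K))))) \<longlonglongrightarrow> (- 1) ^ m * ((L - L) - (\<Sum>i<m. \<kappa> i * 0))"
      using that by (intro tendsto_mult tendsto_diff[OF tendsto_diff] tendsto_sum tendsto_const L zeta_diff_shift_tendsto) auto
    moreover have "(- 1) ^ m * ((hom_sym (Suc m) (Suc (Suc p)) (real K + u) - hom_sym (Suc m) (Suc (Suc p)) (real K + 0))
        - (\<Sum>i<m. \<kappa> i * (zeta_diff (m - i) (real K + u) - zeta_diff (m - i) (real K)))) = G (real K + u) - G (real K)" for K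
      unfolding G_def right_diff_distrib[of "\<kappa> i" for i] sum_subtractf by (simp add: algebra_simps)
    ultimately have "(\<lambda>K. G (real K + u) - G (real K)) \<longlonglongrightarrow> (- 1) ^ m * ((L - L) - (\<Sum>i<m. \<kappa> i * 0))"
      by (simp only:)
    then show ?thesis by simp
  qed
  have "F s - G s = F 0 - G 0"
  proof (rule periodic_const[OF _ _ assms(2)])
    fix u :: real assume "u > 0"
    then show "F u - G u = F (u - 1) - G (u - 1)" using F_diff[of u] G_diff[of u] by simp
  next
    fix u :: real assume "0 \<le> u" "u \<le> 1"
    from tendsto_diff[OF F_shift[OF this] G_shift[OF this]]
    show "(\<lambda>K. F (real K + u) - G (real K + u) - (F (real K) - G (real K))) \<longlonglongrightarrow> 0"
      by (simp add: algebra_simps)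
  qed
  then have "F s = G s" by (simp add: F_def G_def)
  then show ?thesis by (simp only: F_def G_def \<gamma>_def \<kappa>_def)
qed

text \<open>The \<open>m - 1\<close> ones and the \<open>2\<close> consume \<open>m\<close> tail
  sums, and the surplus exponent of the \<open>2\<close> gives one more \<open>div_Suc\<close>. What
  remains is a Taylor coefficient of the function in \<open>newton_tail_sums_eq\<close>.\<close>

lemma mzs_series_in_zeta_ring:
  assumes m: "m \<ge> 1"
  shows "(\<Sum>i. div_Suc (star_seq m (Suc p)) i * mzs i (rep (m - 1) [1] @ [2] @ rep b [1])) \<in> rat_adjoin zeta_values"
proof -
  let ?\<eta> = "div_Suc (star_seq m (Suc p))"
  let ?\<gamma> = "div_Suc (tail_sums ?\<eta> m)"
  have w: "admissible ?\<eta>" by (rule admissible_div_Suc_star_seq)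
  have ones: "\<forall>k\<in>set (rep b [1]). k \<ge> 1" by (auto simp: rep_def)
  have "(\<Sum>i. ?\<eta> i * mzs i (rep (m - 1) [1] @ [2] @ rep b [1]))
      = (\<Sum>l. tail_sums ?\<eta> (m - 1) l * mzs l (Suc 1 # rep b [1]))"
    using ones by (subst suminf_mzs_ones[OF w]) (auto simp: numeral_2_eq_2)
  also have "\<dots> = (\<Sum>l. div_Suc (tail_sum (tail_sums ?\<eta> (m - 1))) l * (mzs l (rep b [1]) / real (Suc l) ^ 1))"
    by (rule suminf_mzs_Cons[OF admissible_tail_sums[OF w] ones])
  also have "div_Suc (tail_sum (tail_sums ?\<eta> (m - 1))) = tail_sums ?\<eta> m"
    using m by (cases m) simp_all
  also have "(\<Sum>l. tail_sums ?\<eta> m l * (mzs l (rep b [1]) / real (Suc l) ^ 1)) = (\<Sum>l. ?\<gamma> l * mzs l (rep b [1]))"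
    by (simp add: div_Suc_def)
  also have "\<dots> \<in> rat_adjoin zeta_values"
  proof (rule powser_over_coeff_mult)
    show "admissible ?\<gamma>" by (intro admissible_div_Suc admissible_tail_sums w)
    have sgn: "(- 1) ^ i \<in> rat_adjoin zeta_values" for i
      by (rule rat_adjoin.rat) simp
    \<comment> \<open>\<open>newton_tail_sums_eq\<close> at \<open>s = - w\<close>, with its
      subtraction written as adding negated coefficients to fit the closure rules.\<close>
    have "powser_over zeta_values (\<lambda>w. - ((- 1) ^ m) * (hom_sym (Suc m) (Suc (Suc p)) (- w)
      + (\<Sum>i<m. - ((- 1) ^ i * suminf (tail_sums ?\<eta> i)) * zeta_diff (m - i) (- w))))"
      by (intro powser_over_cmult powser_over_add powser_over_hom_sym powser_over_sum powser_over_zeta_diff rat_adjoin_uminus rat_adjoin.mult sgn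
          suminf_tail_sums_in_zeta_ring m) auto
    moreover have "- ((- 1) ^ m) * (hom_sym (Suc m) (Suc (Suc p)) (- w)
      + (\<Sum>i<m. - ((- 1) ^ i * suminf (tail_sums ?\<eta> i)) * zeta_diff (m - i) (- w))) = w * newton_sum ?\<gamma> (- w)" if "\<bar>w\<bar> < 1" for w
    proof -
      have "- w > -1" using that by auto
      from newton_tail_sums_eq[OF m this, of p] show ?thesis by (simp add: sum_negf)
    qed
    ultimately show "powser_over zeta_values (\<lambda>w. w * newton_sum ?\<gamma> (- w))"
      unfolding powser_over_def by auto
  qed
  finally show ?thesis .
qed

text \<open>For star sums divided by \<open>Suc i\<close>, prepending \<open>1\<close> to the index
  is \<open>average\<close>, and prepending \<open>2\<close> is \<open>average\<close> after
  \<open>div_Suc\<close>.\<close>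

lemma star_seq_eq_mzs_star:
  assumes "m \<ge> 1"
  shows "star_seq m (Suc p) i = mzs_star (Suc i) (rep p (rep (m - 1) [1] @ [2]) @ rep m [1]) / real (Suc i)"
proof -
  define \<alpha> where "\<alpha> ks i = mzs_star (Suc i) ks / real (Suc i)" for ks i
  have \<alpha>1: "\<alpha> (1 # ks) = average (\<alpha> ks)" and \<alpha>2: "\<alpha> (2 # ks) = average (div_Suc (\<alpha> ks))" for ks
    by (auto simp: fun_eq_iff \<alpha>_def average_def div_Suc_def mzs_star_Cons lessThan_Suc_atMost power2_eq_square)
  have \<alpha>rep: "\<alpha> (rep a [1] @ ks) = (average ^^ a) (\<alpha> ks)" for a ks
    by (induction a) (simp_all add: \<alpha>1[simplified])
  have "\<alpha> (rep p (rep (m - 1) [1] @ [2]) @ rep m [1]) = star_seq m (Suc p)"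
  proof (induction p)
    case 0
    have "\<alpha> [] = div_Suc (\<lambda>_. 1)" by (simp add: fun_eq_iff \<alpha>_def div_Suc_def)
    then show ?case using \<alpha>rep[of m "[]"] by (simp add: star_seq.simps(2))
  next
    case (Suc p)
    have "rep (Suc p) (rep (m - 1) [1] @ [2]) @ rep m [1]
        = rep (m - 1) [1] @ 2 # (rep p (rep (m - 1) [1] @ [2]) @ rep m [1])"
      by simp
    then have "\<alpha> (rep (Suc p) (rep (m - 1) [1] @ [2]) @ rep m [1]) = (average ^^ (m - 1)) (average (div_Suc (star_seq m (Suc p))))"
      by (simp only: \<alpha>rep \<alpha>2 Suc)
    \<comment> \<open>The average from the entry \<open>2\<close> completes those of the
      \<open>m - 1\<close> ones to \<open>m\<close>.\<close>
    also have "\<dots> = (average ^^ Suc (m - 1)) (div_Suc (star_seq m (Suc p)))"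
      by (simp only: funpow_Suc_right o_apply)
    finally show ?case using assms by (simp add: star_seq.simps(2)[of m "Suc p"])
  qed
  then show ?thesis by (simp add: \<alpha>_def fun_eq_iff)
qed

theorem theorem3p7:
  fixes m p b :: nat
  assumes "m \<ge> 1" and "p \<ge> 1"
  shows "(\<lambda>n. mzs n (rep (m - 1) [1] @ [2] @ rep b [1])
                * mzs_star (Suc n) (rep (p - 1) (rep (m - 1) [1] @ [2]) @ rep m [1])
                / real (Suc n) ^ 2)
           sums KY_zeta (rep m [1] @ [2] @ rep b [1])
                  ([1] @ rep (p - 1) (rep (m - 1) [1] @ [2]) @ rep m [1])
         \<and> KY_zeta (rep m [1] @ [2] @ rep b [1])
             ([1] @ rep (p - 1) (rep (m - 1) [1] @ [2]) @ rep m [1])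
           \<in> rat_adjoin {riemann_zeta k | k. k \<ge> 2}"
proof -
  let ?ks = "rep (m - 1) [1] @ [2] @ rep b [1]"
  let ?ls = "rep (p - 1) (rep (m - 1) [1] @ [2]) @ rep m [1]"
  let ?\<eta> = "div_Suc (star_seq m (Suc (p - 1)))"
  \<comment> \<open>Both indices thus begin with \<open>1\<close>, which yields the exponent
    \<open>2\<close> and leaves \<open>m - 1\<close> ones in the tail.\<close>
  have "rep m [1] = 1 # rep (m - 1) [1]"
    using assms(1) by (cases m) simp_all
  then have "KY_term (rep m [1] @ [2] @ rep b [1]) ([1] @ ?ls) n
      = mzs n ?ks * mzs_star (Suc n) ?ls / real (Suc n) ^ 2" for n
    by (simp add: KY_term_def numeral_2_eq_2)
  moreover have "mzs n ?ks * mzs_star (Suc n) ?ls / real (Suc n) ^ 2 = ?\<eta> n * mzs n ?ks" for n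
    by (simp add: div_Suc_def star_seq_eq_mzs_star[OF assms(1)] power2_eq_square)
  moreover have "summable (\<lambda>n. ?\<eta> n * mzs n ?ks)"
    by (intro summable_mzs admissible_div_Suc_star_seq) (auto simp: rep_def)
  moreover have "(\<Sum>n. ?\<eta> n * mzs n ?ks) \<in> rat_adjoin zeta_values"
    by (rule mzs_series_in_zeta_ring[OF assms(1)])
  ultimately show ?thesis
    by (simp add: KY_zeta_def summable_sums)
qed

end
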